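(* Consider the 1/2-equation model (defined in the context) in three dimensions, subject to periodic boundary conditions and with body force $f=f(x)$ satisfying $\nabla\cdot f(x)=0$. With $\varepsilon_{\text{model}}$, $U$, $L$, $T^*$ and $\mathcal{R}e$ as defined in the context, the time averaged energy dissipation rate of the model satisfies $$\Big[1-\sqrt2\,\mu\Big(\frac{\tau}{T^*}\Big)^2\Big]\limsup_{T\to\infty}\frac1T\int_0^T\varepsilon_{\text{model}}(t)\,dt\le 2\,(1+\mathcal{R}e^{-1})\frac{U^3}{L}.$$ With $\mu=0.55$, if $\frac{\tau}{T^*}\le0.8$ then $$\limsup_{T\to\infty}\frac1T\int_0^T\varepsilon_{\text{model}}(t)\,dt\le 4\,(1+\mathcal{R}e^{-1})\frac{U^3}{L}.$$
   Context: The 1/2-equation model, periodic case. Let $\Omega\subset\mathbb{R}^3$ be a periodic box with volume $|\Omega|$, let $\nu>0$ be the kinematic viscosity, $\tau>0$ the time window, $\mu>0$ a calibration constant, and $f=f(x)$ a given time-independent periodic body force for which the scales below are meaningful. The unknowns are the periodic velocity $v(x,t)$ and pressure $q(x,t)$, and a scalar function of time only, $k(t)$. With $\nu_T=\sqrt2\,\mu\,k(t)\,\tau$ the model equations are $$v_t+v\cdot\nabla v-\nabla\cdot\big([2\nu+\nu_T]\nabla^s v\big)+\nabla q=f,\qquad \nabla\cdot v=0,$$ $$\frac{d}{dt}k(t)+\frac{\sqrt2}{2}\tau^{-1}k(t)=\frac1{|\Omega|}\int_\Omega\nu_T|\nabla^s v|^2dx,$$ where $\nabla^s w$ denotes the symmetric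 part of $\nabla w$. The velocity is initialized at $t=0$ by $v(x,0)=v_0(x)$, and the $k$-equation is initialized at some $t^*\ge0$ by a given value $k(t^* )>0$. Standing assumption: the model has a solution which is smooth enough for standard energy estimates. Definitions. The model energy dissipation rate is $$\varepsilon_{\text{model}}(t):=\frac1{|\Omega|}\int_\Omega\nu|\nabla^s v(x,t)|^2dx+\frac{\sqrt2}{2}\tau^{-1}k(t).$$ The scale of the body force $F$, large velocity scale $U$, length scale $L$ and large scale turnover time $T^*$ are $$F:=\Big(\frac1{|\Omega|}\int_\Omega|f(x)|^2dx\Big)^{1/2},\qquad U:=\Big(\limsup_{T\to\infty}\frac1T\int_0^T\Big[\frac1{|\Omega|}\int_\Omega|v(x,t)|^2dx\Big]dt\Big)^{1/2},$$ $$L:=\min\left\{|\Omega|^{1/3},\ \frac{F}{\sup_{x\in\Omega}|\nabla^s f(x)|},\ \frac{F}{\big(\frac1{|\Omega|}\int_\Omega|\nabla^s f(x)|^2dx\big)^{1/2}},\ \sqrt{\frac{F}{\big(\frac1{|\Omega|}\int_\Omega|\Delta f(x)|^2dx\big)^{1/2}}}\right\},\qquad T^*:=\frac LU,$$ and the Reynolds number is $\mathcal{R}e:=LU/\nu$. *)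

theory Defs
  imports "HOL-Analysis.Analysis"
begin

section \<open>Calculus of periodic fields on three-dimensional space\<close>

text \<open>A field on the periodic box with side lengths l is a function on the whole space that is
  periodic in each coordinate direction; the box itself is represented by \<^term>\<open>cbox 0 l\<close>.\<close>

definition periodic :: "real^3 \<Rightarrow> (real^3 \<Rightarrow> 'b) \<Rightarrow> bool" where
  "periodic l g \<longleftrightarrow> (\<forall>x j. g (x + (l $ j) *\<^sub>R axis j 1) = g x)"

definition box_avg :: "real^3 \<Rightarrow> (real^3 \<Rightarrow> real) \<Rightarrow> real" where
  "box_avg l g = integral (cbox 0 l) g / measure lborel (cbox 0 l)"

definition pd :: "3 \<Rightarrow> (real^3 \<Rightarrow> 'b::real_normed_vector) \<Rightarrow> real^3 \<Rightarrow> 'b" where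
  "pd j g x = frechet_derivative g (at x) (axis j 1)"

definition C1 :: "(real^3 \<Rightarrow> 'b::real_normed_vector) \<Rightarrow> bool" where
  "C1 g \<longleftrightarrow> (\<forall>x. g differentiable (at x)) \<and> (\<forall>j. continuous_on UNIV (pd j g))"

definition C2 :: "(real^3 \<Rightarrow> 'b::real_normed_vector) \<Rightarrow> bool" where
  "C2 g \<longleftrightarrow> C1 g \<and> (\<forall>j. C1 (pd j g))"

definition grad :: "(real^3 \<Rightarrow> real) \<Rightarrow> real^3 \<Rightarrow> real^3" where
  "grad p x = (\<chi> i. pd i p x)"

definition divergence :: "(real^3 \<Rightarrow> real^3) \<Rightarrow> real^3 \<Rightarrow> real" where
  "divergence w x = (\<Sum>j\<in>UNIV. pd j w x $ j)"

definition laplacian :: "(real^3 \<Rightarrow> real^3) \<Rightarrow> real^3 \<Rightarrow> real^3" where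
  "laplacian w x = (\<Sum>j\<in>UNIV. pd j (pd j w) x)"

text \<open>The norm of type \<^typ>\<open>real^3^3\<close> is the Frobenius norm, so that
  \<^term>\<open>(norm A)\<^sup>2\<close> is the full contraction of A with itself.\<close>

definition sym_grad :: "(real^3 \<Rightarrow> real^3) \<Rightarrow> real^3 \<Rightarrow> real^3^3" where
  "sym_grad w x = (1/2) *\<^sub>R (jacobian w (at x) + transpose (jacobian w (at x)))"

definition tensor_div :: "(real^3 \<Rightarrow> real^3^3) \<Rightarrow> real^3 \<Rightarrow> real^3" where
  "tensor_div S x = (\<chi> i. \<Sum>j\<in>UNIV. pd j (\<lambda>y. S y $ i $ j) x)"


section \<open>The 1/2-equation model\<close>

definition eddy_visc :: "real \<Rightarrow> real \<Rightarrow> (real \<Rightarrow> real) \<Rightarrow> real \<Rightarrow> real" where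
  "eddy_visc \<mu> \<tau> k t = sqrt 2 * \<mu> * k t * \<tau>"

text \<open>Classical solutions, global in time, with the regularity needed for the energy estimates.
  The k-equation starts at \<open>ts\<close>. On \<open>[0, ts)\<close> the function k is only required to be integrable;
  this admits both \<open>k = 0\<close> (no model active) and the solution of the k-equation extended back
  to time 0. As k may jump at \<open>ts\<close>, the time derivative of v need not exist there.\<close>

locale half_equation_model =
  fixes l :: "real^3" and \<nu> \<tau> \<mu> :: real
    and f v0 :: "real^3 \<Rightarrow> real^3" and ts ks :: real
    and v :: "real \<Rightarrow> real^3 \<Rightarrow> real^3" and q :: "real \<Rightarrow> real^3 \<Rightarrow> real" and k :: "real \<Rightarrow> real"
  assumes l_pos: "\<And>j. l $ j > 0"
    and nu_pos: "\<nu> > 0" and tau_pos: "\<tau> > 0" and mu_pos: "\<mu> > 0"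
    and ts_nonneg: "ts \<ge> 0" and ks_pos: "ks > 0"
    and f_C2: "C2 f" and f_periodic: "periodic l f"
    and v_periodic: "\<And>t. t \<ge> 0 \<Longrightarrow> periodic l (v t)"
    and q_periodic: "\<And>t. t > 0 \<Longrightarrow> periodic l (q t)"
    and v_C1: "\<And>t. t \<ge> 0 \<Longrightarrow> C1 (v t)"
    and v_cont: "continuous_on ({0..} \<times> UNIV) (\<lambda>(t, x). v t x)"
    and v_pd_cont: "\<And>i. continuous_on ({0..} \<times> UNIV) (\<lambda>(t, x). pd i (v t) x)"
    and v_C2: "\<And>t. t > 0 \<Longrightarrow> t \<noteq> ts \<Longrightarrow> C2 (v t)"
    and v_pd2_cont: "\<And>i j. continuous_on (({0<..} - {ts}) \<times> UNIV) (\<lambda>(t, x). pd i (pd j (v t)) x)"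
    and v_t_ex: "\<And>t x. t > 0 \<Longrightarrow> t \<noteq> ts \<Longrightarrow> (\<lambda>s. v s x) differentiable (at t)"
    and v_t_cont: "continuous_on (({0<..} - {ts}) \<times> UNIV)
                     (\<lambda>(t, x). vector_derivative (\<lambda>s. v s x) (at t))"
    and q_C1: "\<And>t. t > 0 \<Longrightarrow> t \<noteq> ts \<Longrightarrow> C1 (q t)"
    and k_integrable: "k absolutely_integrable_on {0..ts}"
    and k_cont: "continuous_on {ts..} k"
    and k_differentiable: "\<And>t. t > ts \<Longrightarrow> k field_differentiable (at t)"
    and v_init: "\<And>x. v 0 x = v0 x"
    and k_init: "k ts = ks"
    and momentum: "\<And>t x. t > 0 \<Longrightarrow> t \<noteq> ts \<Longrightarrow>
      vector_derivative (\<lambda>s. v s x) (at t) + jacobian (v t) (at x) *v v t x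
        - tensor_div (\<lambda>y. (2 * \<nu> + eddy_visc \<mu> \<tau> k t) *\<^sub>R sym_grad (v t) y) x + grad (q t) x = f x"
    and incompressible: "\<And>t x. t > 0 \<Longrightarrow> divergence (v t) x = 0"
    and k_equation: "\<And>t. t > ts \<Longrightarrow>
      deriv k t + sqrt 2 / 2 * inverse \<tau> * k t
        = box_avg l (\<lambda>x. eddy_visc \<mu> \<tau> k t * (norm (sym_grad (v t) x))\<^sup>2)"

definition eps_model ::
  "real^3 \<Rightarrow> real \<Rightarrow> real \<Rightarrow> (real \<Rightarrow> real^3 \<Rightarrow> real^3) \<Rightarrow> (real \<Rightarrow> real) \<Rightarrow> real \<Rightarrow> real" where
  "eps_model l \<nu> \<tau> v k t
     = box_avg l (\<lambda>x. \<nu> * (norm (sym_grad (v t) x))\<^sup>2) + sqrt 2 / 2 * inverse \<tau> * k t"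


section \<open>Scales\<close>

definition limsup_time_avg :: "(real \<Rightarrow> real) \<Rightarrow> ereal" where
  "limsup_time_avg g = Limsup at_top (\<lambda>T. ereal (1 / T * integral {0..T} g))"

definition force_scale :: "real^3 \<Rightarrow> (real^3 \<Rightarrow> real^3) \<Rightarrow> real" where
  "force_scale l f = sqrt (box_avg l (\<lambda>x. (norm (f x))\<^sup>2))"

definition sup_sym_grad :: "real^3 \<Rightarrow> (real^3 \<Rightarrow> real^3) \<Rightarrow> real" where
  "sup_sym_grad l f = (SUP x\<in>cbox 0 l. norm (sym_grad f x))"

definition rms_sym_grad :: "real^3 \<Rightarrow> (real^3 \<Rightarrow> real^3) \<Rightarrow> real" where
  "rms_sym_grad l f = sqrt (box_avg l (\<lambda>x. (norm (sym_grad f x))\<^sup>2))"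

definition rms_laplacian :: "real^3 \<Rightarrow> (real^3 \<Rightarrow> real^3) \<Rightarrow> real" where
  "rms_laplacian l f = sqrt (box_avg l (\<lambda>x. (norm (laplacian f x))\<^sup>2))"

definition length_scale :: "real^3 \<Rightarrow> (real^3 \<Rightarrow> real^3) \<Rightarrow> real" where
  "length_scale l f = Min {root 3 (measure lborel (cbox 0 l)),
      force_scale l f / sup_sym_grad l f,
      force_scale l f / rms_sym_grad l f,
      sqrt (force_scale l f / rms_laplacian l f)}"

text \<open>The quotients defining the length scale are meaningful and nonzero.\<close>

definition meaningful_scales :: "real^3 \<Rightarrow> (real^3 \<Rightarrow> real^3) \<Rightarrow> bool" where
  "meaningful_scales l f \<longleftrightarrow> force_scale l f > 0 \<and> sup_sym_grad l f > 0
      \<and> rms_sym_grad l f > 0 \<and> rms_laplacian l f > 0"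

text \<open>The upper limit defining the velocity scale is taken in the extended reals, so neither
  its finiteness nor its positivity has to be assumed. If it is 0, then
  \<open>T\<^sup>* = \<infinity>\<close>, \<open>Re = 0\<close> and \<open>inverse Re * U ^ 3 = \<infinity> * 0 = 0\<close>; if it is \<open>\<infinity>\<close>, then \<open>T\<^sup>* = 0\<close> and
  \<open>Re = \<infinity>\<close>. \<open>ereal_sqrt\<close> is meant for nonnegative arguments only.\<close>

definition ereal_sqrt :: "ereal \<Rightarrow> ereal" where
  "ereal_sqrt a = (if a = \<infinity> then \<infinity> else ereal (sqrt (real_of_ereal a)))"

definition velocity_scale :: "real^3 \<Rightarrow> (real \<Rightarrow> real^3 \<Rightarrow> real^3) \<Rightarrow> ereal" where
  "velocity_scale l v = ereal_sqrt (limsup_time_avg (\<lambda>t. box_avg l (\<lambda>x. (norm (v t x))\<^sup>2)))"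

definition turnover_time ::
  "real^3 \<Rightarrow> (real^3 \<Rightarrow> real^3) \<Rightarrow> (real \<Rightarrow> real^3 \<Rightarrow> real^3) \<Rightarrow> ereal" where
  "turnover_time l f v = ereal (length_scale l f) / velocity_scale l v"

definition reynolds ::
  "real^3 \<Rightarrow> real \<Rightarrow> (real^3 \<Rightarrow> real^3) \<Rightarrow> (real \<Rightarrow> real^3 \<Rightarrow> real^3) \<Rightarrow> ereal" where
  "reynolds l \<nu> f v = ereal (length_scale l f) * velocity_scale l v / ereal \<nu>"

end

theory Submission
  imports Defs
begin

text \<open>Write N, D and M for the box averages of \<open>|v|\<^sup>2\<close>, \<open>|S v|\<^sup>2\<close> and \<open>f \<bullet> v\<close>, where S is the symmetric
  gradient, and e for \<open>sqrt 2 / 2 * k / \<tau>\<close>, so that \<open>\<epsilon> = \<nu> D + e\<close> and the eddy viscosity is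
  \<open>\<kappa> = 2 \<mu> \<tau>\<^sup>2 e\<close>. Testing the momentum equation with v and adding the k-equation gives
  \<open>(N/2 + k)' + \<nu> D + \<epsilon> = M\<close>, hence the time average of \<open>\<epsilon>\<close> is at most \<open>F U\<close>. Testing with f gives
  \<open>F\<^sup>2 \<le> M' + (F/L) N + \<nu> (F/L\<^sup>2) sqrt N + \<kappa> sqrt D F / (sqrt 2 L)\<close>. After multiplication by \<open>U/F\<close>, Young's
  inequality splits the last term into \<open>\<kappa> D / 2\<close>, which the energy equation bounds by \<open>F U / 2\<close> on average,
  and \<open>\<kappa> U\<^sup>2 / (4 L\<^sup>2) = (\<mu>/2) (\<tau>/T\<^sup>*)\<^sup>2 e\<close>. Averaging yields
  \<open>F U \<le> 2 (1 + 1/Re) U\<^sup>3/L + \<mu> (\<tau>/T\<^sup>*)\<^sup>2 \<langle>\<epsilon>\<rangle>\<close> and the theorem follows from \<open>\<mu> \<le> sqrt 2 \<mu>\<close>.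
  When \<open>U = 0\<close> the energy estimate alone shows that \<open>\<langle>\<epsilon>\<rangle> = 0\<close>.\<close>

section \<open>Partial derivatives and periodic boxes\<close>

text \<open>Stated within an arbitrary set \<open>A\<close>, so that it serves both the fundamental
  theorem on an interval and differentiation under the integral sign.\<close>

lemma has_vector_derivative_line:
  fixes g :: "real^3 \<Rightarrow> 'b::real_normed_vector"
  assumes "g differentiable (at (x + s *\<^sub>R axis j 1))"
  shows "((\<lambda>s. g (x + s *\<^sub>R axis j 1)) has_vector_derivative pd j g (x + s *\<^sub>R axis j 1)) (at s within A)"
proof -
  let ?e = "axis j 1 :: real^3"
  let ?D = "frechet_derivative g (at (x + s *\<^sub>R ?e))"
  have g: "(g has_derivative ?D) (at (x + s *\<^sub>R ?e))"
    using assms frechet_derivative_works by blast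
  have line: "((\<lambda>s. x + s *\<^sub>R ?e) has_derivative (\<lambda>h. h *\<^sub>R ?e)) (at s within A)"
    by (auto intro!: derivative_eq_intros)
  have "((\<lambda>s. g (x + s *\<^sub>R ?e)) has_derivative (\<lambda>h. ?D (h *\<^sub>R ?e))) (at s within A)"
    by (rule has_derivative_compose[OF line g])
  then show ?thesis
    using linear_cmul[OF has_derivative_linear[OF g]]
    by (simp add: has_vector_derivative_def pd_def)
qed

lemma pd_eqI:
  assumes "(g has_derivative g') (at x)"
  shows "pd j g x = g' (axis j 1)"
  unfolding pd_def using frechet_derivative_at[OF assms] by simp

lemma C1_has_derivative:
  assumes "C1 g"
  shows "(g has_derivative frechet_derivative g (at x)) (at x)"
  using assms frechet_derivative_works by (auto simp: C1_def)

lemma C1_continuous: "C1 g \<Longrightarrow> continuous_on A g"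
  by (meson C1_has_derivative continuous_at_imp_continuous_on has_derivative_continuous)

lemma C1_pd_continuous: "C1 g \<Longrightarrow> continuous_on A (pd j g)"
  unfolding C1_def using continuous_on_subset by blast

lemma pd_nth:
  fixes w :: "real^3 \<Rightarrow> 'b::real_normed_vector^'n"
  assumes "C1 w"
  shows "pd j (\<lambda>y. w y $ i) x = pd j w x $ i"
  using pd_eqI[OF bounded_linear.has_derivative[OF bounded_linear_vec_nth C1_has_derivative[OF assms]]]
  by (simp add: pd_def)

lemma C1_nth:
  fixes w :: "real^3 \<Rightarrow> 'b::real_normed_vector^'n"
  assumes "C1 w"
  shows "C1 (\<lambda>y. w y $ i)"
proof -
  have "(\<lambda>y. w y $ i) differentiable at x" for x
    using bounded_linear.has_derivative[OF bounded_linear_vec_nth C1_has_derivative[OF assms]]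
    unfolding differentiable_def by blast
  moreover have "continuous_on UNIV (pd j (\<lambda>y. w y $ i))" for j
    by (simp add: pd_nth[OF assms] continuous_on_component C1_pd_continuous[OF assms] cong: continuous_on_cong)
  ultimately show ?thesis by (simp add: C1_def)
qed

lemma pd_mult:
  fixes g h :: "real^3 \<Rightarrow> real"
  assumes "C1 g" "C1 h"
  shows "pd j (\<lambda>y. g y * h y) x = pd j g x * h x + g x * pd j h x"
  using pd_eqI[OF has_derivative_mult[OF C1_has_derivative[OF assms(1)] C1_has_derivative[OF assms(2)]]]
  by (simp add: pd_def)

lemma C1_mult:
  fixes g h :: "real^3 \<Rightarrow> real"
  assumes "C1 g" "C1 h"
  shows "C1 (\<lambda>y. g y * h y)"
proof -
  have "(\<lambda>y. g y * h y) differentiable at x" for x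
    using has_derivative_mult[OF C1_has_derivative[OF assms(1)] C1_has_derivative[OF assms(2)]]
    unfolding differentiable_def by blast
  moreover have "continuous_on UNIV (pd j (\<lambda>y. g y * h y))" for j
    unfolding pd_mult[OF assms, abs_def]
    by (intro continuous_intros C1_continuous C1_pd_continuous assms)
  ultimately show ?thesis by (simp add: C1_def)
qed

lemma pd_add:
  assumes "C1 g" "C1 h"
  shows "pd j (\<lambda>y. g y + h y) x = pd j g x + pd j h x"
  using pd_eqI[OF has_derivative_add[OF C1_has_derivative[OF assms(1)] C1_has_derivative[OF assms(2)]]]
  by (simp add: pd_def)

lemma C1_add:
  assumes "C1 g" "C1 h"
  shows "C1 (\<lambda>y. g y + h y)"
proof -
  have "(\<lambda>y. g y + h y) differentiable at x" for x
    using has_derivative_add[OF C1_has_derivative[OF assms(1)] C1_has_derivative[OF assms(2)]]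
    unfolding differentiable_def by blast
  moreover have "continuous_on UNIV (pd j (\<lambda>y. g y + h y))" for j
    unfolding pd_add[OF assms, abs_def]
    by (intro continuous_intros C1_continuous C1_pd_continuous assms)
  ultimately show ?thesis by (simp add: C1_def)
qed

lemma pd_cmult:
  fixes g :: "real^3 \<Rightarrow> real"
  assumes "C1 g"
  shows "pd j (\<lambda>y. c * g y) x = c * pd j g x"
  using pd_eqI[OF has_derivative_mult_right[OF C1_has_derivative[OF assms]]]
  by (simp add: pd_def)

lemma C1_cmult:
  fixes g :: "real^3 \<Rightarrow> real"
  assumes "C1 g"
  shows "C1 (\<lambda>y. c * g y)"
proof -
  have "(\<lambda>y. c * g y) differentiable at x" for x
    using has_derivative_mult_right[OF C1_has_derivative[OF assms]]
    unfolding differentiable_def by blast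
  moreover have "continuous_on UNIV (pd j (\<lambda>y. c * g y))" for j
    unfolding pd_cmult[OF assms, abs_def]
    by (intro continuous_intros C1_pd_continuous assms)
  ultimately show ?thesis by (simp add: C1_def)
qed

lemma periodic_pd:
  assumes "periodic l g"
  shows "periodic l (pd j g)"
proof -
  have "pd j g (x + a) = pd j g x" if a: "\<And>x. g (x + a) = g x" for x a
  proof -
    \<comment> \<open>The equivalence covers every candidate \<open>D\<close>, so the choice
      operator inside \<open>frechet_derivative\<close> picks the same map at both points.\<close>
    have shift: "(g has_derivative D) (at (x + a)) \<longleftrightarrow> (g has_derivative D) (at x)" for D
    proof -
      have tr: "((\<lambda>y. y + b) has_derivative (\<lambda>h. h)) (at y)" for b y :: "real^3"
        by (auto intro!: derivative_eq_intros)
      have g': "g (y - a) = g y" for y using a[of "y - a"] by simp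
      show ?thesis
        using has_derivative_compose[OF tr[of a x], of g D]
          has_derivative_compose[OF tr[of "-a" "x + a"], of g D] by (auto simp: a g')
    qed
    show ?thesis unfolding pd_def frechet_derivative_def shift ..
  qed
  then show ?thesis using assms unfolding periodic_def by metis
qed

text \<open>The shifted box sticks out over one face. Cutting at \<open>l $ j - s\<close> and moving
  the protruding slab back by one period rearranges the pieces into the original box, cut at
  \<open>s\<close>.\<close>

lemma integral_box_shift:
  fixes g :: "real^3 \<Rightarrow> real"
  assumes cont: "continuous_on UNIV g" and per: "periodic l g"
    and s: "0 \<le> s" "s \<le> l $ j"
  shows "integral (cbox 0 l) (\<lambda>x. g (x + s *\<^sub>R axis j 1)) = integral (cbox 0 l) g"
proof -
  let ?e = "axis j 1 :: real^3" and ?I = "\<lambda>c. {x::real^3. x $ j \<le> c}"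
  let ?J = "\<lambda>c. {x::real^3. x $ j \<ge> c}"
  have e: "?e \<in> Basis" by simp
  have int: "continuous_on UNIV h \<Longrightarrow> h integrable_on cbox a b" for h :: "real^3 \<Rightarrow> real" and a b
    using integrable_continuous continuous_on_subset by blast
  have split: "integral (cbox 0 l) h = integral (cbox 0 l \<inter> ?I c) h + integral (cbox 0 l \<inter> ?J c) h"
    if "continuous_on UNIV h" for h :: "real^3 \<Rightarrow> real" and c
    using integral_split[OF int[OF that, of 0 l] e, of c] by (simp add: inner_axis)
  have cbox_I: "cbox 0 l \<inter> ?I c = cbox 0 (\<chi> i. if i = j then c else l $ i)" if "c \<le> l $ j" for c
    using that by (auto simp: mem_box_cart split: if_splits) (metis order.trans)
  have cbox_J: "cbox 0 l \<inter> ?J c = cbox (\<chi> i. if i = j then c else 0) l" if "0 \<le> c" for c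
    using that by (auto simp: mem_box_cart split: if_splits) (metis order.trans)
  have shift: "integral (cbox a b) (\<lambda>x. g (x + c)) = integral (cbox (a + c) (b + c)) g" for a b c
    using integral_shift_cbox_plus[of a b g c] by (simp add: o_def add.commute)
  have wrap: "g (x + s *\<^sub>R ?e) = g (x + (s - l $ j) *\<^sub>R ?e)" for x
  proof -
    have "g ((x + (s - l $ j) *\<^sub>R ?e) + (l $ j) *\<^sub>R ?e) = g (x + (s - l $ j) *\<^sub>R ?e)"
      using per unfolding periodic_def by blast
    then show ?thesis by (simp add: scaleR_diff_left algebra_simps)
  qed
  have cont': "continuous_on UNIV (\<lambda>x. g (x + c))" for c
    by (intro continuous_on_compose2[OF cont] continuous_intros) auto
  \<comment> \<open>\<open>v1\<close> and \<open>v2\<close> locate the near slab after the shift by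
    \<open>s\<close>, \<open>v3\<close> and \<open>v4\<close> the far slab after the shift by
    \<open>s - l $ j\<close>.\<close>
  have v1: "(\<chi> i. if i = j then l $ j - s else l $ i) + s *\<^sub>R ?e = l"
    by (simp add: vec_eq_iff axis_def)
  have v2: "0 + s *\<^sub>R ?e = (\<chi> i. if i = j then s else 0)"
    by (simp add: vec_eq_iff axis_def)
  have v3: "(\<chi> i. if i = j then l $ j - s else 0) + (s - l $ j) *\<^sub>R ?e = 0"
    by (simp add: vec_eq_iff axis_def)
  have v4: "l + (s - l $ j) *\<^sub>R ?e = (\<chi> i. if i = j then s else l $ i)"
    by (simp add: vec_eq_iff axis_def)
  have "integral (cbox 0 l) (\<lambda>x. g (x + s *\<^sub>R ?e))
      = integral (cbox 0 l \<inter> ?I (l $ j - s)) (\<lambda>x. g (x + s *\<^sub>R ?e))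
        + integral (cbox 0 l \<inter> ?J (l $ j - s)) (\<lambda>x. g (x + (s - l $ j) *\<^sub>R ?e))"
    unfolding wrap[symmetric] by (rule split[OF cont'])
  also have "integral (cbox 0 l \<inter> ?I (l $ j - s)) (\<lambda>x. g (x + s *\<^sub>R ?e))
      = integral (cbox 0 l \<inter> ?J s) g"
    using s shift[of 0 "\<chi> i. if i = j then l $ j - s else l $ i" "s *\<^sub>R ?e"] unfolding v1 v2
    by (simp add: cbox_I cbox_J)
  also have "integral (cbox 0 l \<inter> ?J (l $ j - s)) (\<lambda>x. g (x + (s - l $ j) *\<^sub>R ?e))
      = integral (cbox 0 l \<inter> ?I s) g"
    using s by (simp add: cbox_I cbox_J shift v3 v4)
  finally show ?thesis using split[OF cont, of s] by simp
qed

text \<open>The integral of g over the box does not change when g is shifted; differentiate in the shift.\<close>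

lemma integral_box_pd:
  fixes g :: "real^3 \<Rightarrow> real"
  assumes g: "C1 g" "periodic l g" and l: "l $ j > 0"
  shows "integral (cbox 0 l) (pd j g) = 0"
proof -
  let ?e = "axis j 1 :: real^3" and ?G = "\<lambda>s. integral (cbox 0 l) (\<lambda>x. g (x + s *\<^sub>R axis j 1))"
  have "(?G has_vector_derivative integral (cbox 0 l) (\<lambda>x. pd j g (x + 0 *\<^sub>R ?e))) (at 0 within {0..l $ j})"
  proof (rule leibniz_rule_vector_derivative)
    show "continuous_on ({0..l $ j} \<times> cbox 0 l) (\<lambda>(s, x). pd j g (x + s *\<^sub>R ?e))"
      unfolding case_prod_beta
      by (intro continuous_on_compose2[OF C1_pd_continuous[OF g(1), of UNIV]] continuous_intros) auto
    show "(\<lambda>x. g (x + s *\<^sub>R ?e)) integrable_on cbox 0 l" for s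
      by (intro integrable_continuous continuous_on_compose2[OF C1_continuous[OF g(1), of UNIV]] continuous_intros) auto
    show "((\<lambda>s. g (x + s *\<^sub>R ?e)) has_vector_derivative pd j g (x + s *\<^sub>R ?e)) (at s within {0..l $ j})" for s x
      using g(1) by (intro has_vector_derivative_line) (auto simp: C1_def)
  qed (use l in auto)
  moreover have "(?G has_vector_derivative 0) (at 0 within {0..l $ j})"
  proof (rule has_vector_derivative_transform)
    show "((\<lambda>s. integral (cbox 0 l) g) has_vector_derivative 0) (at 0 within {0..l $ j})"
      by (rule has_vector_derivative_const)
    show "?G s = integral (cbox 0 l) g" if "s \<in> {0..l $ j}" for s
      using that by (intro integral_box_shift C1_continuous g) auto
  qed (use l in auto)
  ultimately have "integral (cbox 0 l) (\<lambda>x. pd j g (x + 0 *\<^sub>R ?e)) = 0"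
    using l by (intro vector_derivative_unique_within_closed_interval[of 0 "l $ j" 0 ?G]) simp_all
  then show ?thesis by simp
qed

text \<open>The increment of \<open>b\<close> in direction \<open>i\<close> is an integral of
  \<open>pd i b\<close>. Differentiating it in direction \<open>j\<close> under the integral sign,
  and then in the length \<open>s\<close> of the segment, produces both orders of
  differentiation.\<close>

lemma pd_commute:
  fixes b :: "real^3 \<Rightarrow> real"
  assumes b: "C2 b"
  shows "pd i (pd j b) x = pd j (pd i b) x"
proof -
  let ?ei = "axis i 1 :: real^3" and ?ej = "axis j 1 :: real^3"
  have C1b: "C1 b" and C1pd: "C1 (pd m b)" for m using b by (auto simp: C2_def)
  have diff: "b differentiable at y" "pd m b differentiable at y" for y m
    using C1b C1pd by (auto simp: C1_def)
  have inc: "integral (cbox 0 s) (\<lambda>\<sigma>. pd i b (x + \<sigma> *\<^sub>R ?ei + t *\<^sub>R ?ej))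
      = b (x + s *\<^sub>R ?ei + t *\<^sub>R ?ej) - b (x + t *\<^sub>R ?ej)" if "s \<ge> 0" for s t
  proof (rule integral_unique)
    have "((\<lambda>\<sigma>. pd i b ((x + t *\<^sub>R ?ej) + \<sigma> *\<^sub>R ?ei)) has_integral
        b ((x + t *\<^sub>R ?ej) + s *\<^sub>R ?ei) - b ((x + t *\<^sub>R ?ej) + 0 *\<^sub>R ?ei)) {0..s}"
      using that by (intro fundamental_theorem_of_calculus has_vector_derivative_line diff)
    then show "((\<lambda>\<sigma>. pd i b (x + \<sigma> *\<^sub>R ?ei + t *\<^sub>R ?ej)) has_integral
        b (x + s *\<^sub>R ?ei + t *\<^sub>R ?ej) - b (x + t *\<^sub>R ?ej)) (cbox 0 s)"
      by (simp add: algebra_simps)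
  qed
  have eq: "integral {0..s} (\<lambda>\<sigma>. pd j (pd i b) (x + \<sigma> *\<^sub>R ?ei))
      = pd j b (x + s *\<^sub>R ?ei) - pd j b x" if "s \<ge> 0" for s
  proof -
    have "((\<lambda>t. integral (cbox 0 s) (\<lambda>\<sigma>. pd i b (x + \<sigma> *\<^sub>R ?ei + t *\<^sub>R ?ej))) has_vector_derivative
        integral (cbox 0 s) (\<lambda>\<sigma>. pd j (pd i b) (x + \<sigma> *\<^sub>R ?ei + 0 *\<^sub>R ?ej))) (at 0 within UNIV)"
    proof (rule leibniz_rule_vector_derivative)
      show "continuous_on (UNIV \<times> cbox 0 s) (\<lambda>(t, \<sigma>). pd j (pd i b) (x + \<sigma> *\<^sub>R ?ei + t *\<^sub>R ?ej))"
        unfolding case_prod_beta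
        by (intro continuous_on_compose2[OF C1_pd_continuous[OF C1pd, of UNIV]] continuous_intros) auto
      show "(\<lambda>\<sigma>. pd i b (x + \<sigma> *\<^sub>R ?ei + t *\<^sub>R ?ej)) integrable_on cbox 0 s" for t
        by (intro integrable_continuous continuous_on_compose2[OF C1_continuous[OF C1pd, of UNIV]] continuous_intros) auto
    qed (auto intro!: has_vector_derivative_line diff)
    moreover have "((\<lambda>t. b ((x + s *\<^sub>R ?ei) + t *\<^sub>R ?ej) - b (x + t *\<^sub>R ?ej)) has_vector_derivative
        pd j b ((x + s *\<^sub>R ?ei) + 0 *\<^sub>R ?ej) - pd j b (x + 0 *\<^sub>R ?ej)) (at 0)"
      by (intro has_vector_derivative_diff has_vector_derivative_line diff)
    ultimately have "integral (cbox 0 s) (\<lambda>\<sigma>. pd j (pd i b) (x + \<sigma> *\<^sub>R ?ei + 0 *\<^sub>R ?ej))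
        = pd j b ((x + s *\<^sub>R ?ei) + 0 *\<^sub>R ?ej) - pd j b (x + 0 *\<^sub>R ?ej)"
      unfolding inc[OF that] by (rule vector_derivative_unique_at)
    then show ?thesis by simp
  qed
  \<comment> \<open>The same function of \<open>s\<close> is differentiated at 0 twice, by the
    fundamental theorem and through \<open>eq\<close>. Since \<open>eq\<close> covers only
    nonnegative \<open>s\<close>, the derivatives are one-sided.\<close>
  have "((\<lambda>s. integral {0..s} (\<lambda>\<sigma>. pd j (pd i b) (x + \<sigma> *\<^sub>R ?ei))) has_vector_derivative
      pd j (pd i b) (x + 0 *\<^sub>R ?ei)) (at 0 within {0..1})"
  proof (rule integral_has_vector_derivative[where f = "\<lambda>\<sigma>. pd j (pd i b) (x + \<sigma> *\<^sub>R ?ei)"])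
    show "continuous_on {0..1} (\<lambda>\<sigma>. pd j (pd i b) (x + \<sigma> *\<^sub>R ?ei))"
      by (intro continuous_on_compose2[OF C1_pd_continuous[OF C1pd, of UNIV]] continuous_intros) auto
  qed auto
  moreover have "((\<lambda>s. integral {0..s} (\<lambda>\<sigma>. pd j (pd i b) (x + \<sigma> *\<^sub>R ?ei))) has_vector_derivative
      pd i (pd j b) (x + 0 *\<^sub>R ?ei) - 0) (at 0 within {0..1})"
  proof (rule has_vector_derivative_transform)
    show "((\<lambda>s. pd j b (x + s *\<^sub>R ?ei) - pd j b x) has_vector_derivative
        pd i (pd j b) (x + 0 *\<^sub>R ?ei) - 0) (at 0 within {0..1})"
      by (rule has_vector_derivative_diff[OF has_vector_derivative_line[OF diff(2)] has_vector_derivative_const])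
  qed (use eq in auto)
  ultimately have "pd j (pd i b) (x + 0 *\<^sub>R ?ei) = pd i (pd j b) (x + 0 *\<^sub>R ?ei) - 0"
    by (intro vector_derivative_unique_within_closed_interval[of 0 1 0]) simp_all
  then show ?thesis by simp
qed

lemma pd_const: "pd j (\<lambda>x. c) x = 0"
  by (rule pd_eqI[OF has_derivative_const])

lemma C1_const: "C1 (\<lambda>x. c)"
  unfolding C1_def by (auto simp: pd_const[abs_def])

lemma C1_sum: "finite I \<Longrightarrow> (\<And>i. i \<in> I \<Longrightarrow> C1 (g i)) \<Longrightarrow> C1 (\<lambda>x. \<Sum>i\<in>I. g i x)"
  by (induction I rule: finite_induct) (auto intro: C1_const C1_add)

lemma pd_sum:
  "finite I \<Longrightarrow> (\<And>i. i \<in> I \<Longrightarrow> C1 (g i)) \<Longrightarrow> pd j (\<lambda>x. \<Sum>i\<in>I. g i x) x = (\<Sum>i\<in>I. pd j (g i) x)"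
  by (induction I rule: finite_induct) (auto simp: pd_const pd_add C1_sum)

lemma C2_C1: "C2 w \<Longrightarrow> C1 w" and C2_C1_pd: "C2 w \<Longrightarrow> C1 (pd j w)"
  by (auto simp: C2_def)

lemma pd_nth_fun:
  fixes w :: "real^3 \<Rightarrow> real^'n"
  shows "C1 w \<Longrightarrow> pd j (\<lambda>y. w y $ i) = (\<lambda>x. pd j w x $ i)"
  using pd_nth by blast

lemma C2_nth: 
  fixes w :: "real^3 \<Rightarrow> real^'n"
  assumes "C2 w" shows "C2 (\<lambda>y. w y $ i)"
  using assms by (auto simp: C2_def C1_nth pd_nth_fun)

lemma periodic_nth: "periodic l w \<Longrightarrow> periodic l (\<lambda>x. w x $ i)"
  and periodic_mult: "periodic l g \<Longrightarrow> periodic l h \<Longrightarrow> periodic l (\<lambda>x. (g x * h x :: real))"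
  and periodic_add: "periodic l a \<Longrightarrow> periodic l b \<Longrightarrow> periodic l (\<lambda>x. (a x + b x :: real))"
  and periodic_cmult: "periodic l g \<Longrightarrow> periodic l (\<lambda>x. (c * g x :: real))"
  by (auto simp: periodic_def)

lemma periodic_sum: "(\<And>i. i \<in> I \<Longrightarrow> periodic l (g i)) \<Longrightarrow> periodic l (\<lambda>x. \<Sum>i\<in>I. (g i x :: real))"
  by (auto simp: periodic_def intro!: sum.cong)

section \<open>Integration by parts\<close>

lemma sym_grad_nth: "sym_grad w x $ i $ j = 1/2 * (pd j w x $ i + pd i w x $ j)"
  by (simp add: sym_grad_def jacobian_def matrix_def transpose_def pd_def)

lemma sym_grad_C1:
  assumes "C2 w" shows "C1 (\<lambda>x. sym_grad w x $ i $ j)"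
  unfolding sym_grad_nth by (intro C1_cmult C1_add C1_nth C2_C1_pd assms)

lemma sym_grad_periodic:
  assumes "periodic l w" shows "periodic l (\<lambda>x. sym_grad w x $ i $ j)"
  unfolding sym_grad_nth by (intro periodic_cmult periodic_add periodic_nth periodic_pd assms)

lemma pd_sym_grad:
  assumes "C2 w"
  shows "pd m (\<lambda>x. sym_grad w x $ i $ j) x = 1/2 * (pd m (pd j w) x $ i + pd m (pd i w) x $ j)"
  unfolding sym_grad_nth
  by (simp only: pd_cmult pd_add pd_nth C1_add C1_nth C2_C1_pd assms)

lemma continuous_on_sym_grad:
  assumes "\<And>j. continuous_on A (pd j w)"
  shows "continuous_on A (sym_grad w)"
proof -
  have "continuous_on A (\<lambda>x. \<chi> i j. sym_grad w x $ i $ j)"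
    unfolding sym_grad_nth by (intro continuous_intros assms)
  then show ?thesis by simp
qed

lemma matrix_inner: "(A::real^'n^'m) \<bullet> B = (\<Sum>i\<in>UNIV. \<Sum>j\<in>UNIV. A $ i $ j * B $ i $ j)"
  by (simp add: inner_vec_def)

lemma integral_box_div:
  fixes F :: "3 \<Rightarrow> real^3 \<Rightarrow> real"
  assumes "\<And>j. C1 (F j)" "\<And>j. periodic l (F j)" "\<And>j. l $ j > 0"
  shows "((\<lambda>x. \<Sum>j\<in>UNIV. pd j (F j) x) has_integral 0) (cbox 0 l)"
proof -
  have "((\<lambda>x. \<Sum>j\<in>UNIV. pd j (F j) x) has_integral (\<Sum>j\<in>UNIV. integral (cbox 0 l) (pd j (F j)))) (cbox 0 l)"
    by (intro has_integral_sum integrable_integral integrable_continuous C1_pd_continuous assms) auto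
  then show ?thesis using assms by (simp add: integral_box_pd)
qed

text \<open>Integration by parts reduced to exhibiting a periodic flux \<open>F\<close> and checking
  a pointwise identity. Integrability of \<open>g\<close> follows from adding two
  \<open>has_integral\<close> facts.\<close>

lemma integral_box_eqI:
  fixes F :: "3 \<Rightarrow> real^3 \<Rightarrow> real"
  assumes "\<And>j. C1 (F j)" "\<And>j. periodic l (F j)" "\<And>j. l $ j > 0"
    and "\<And>x. g x = h x + (\<Sum>j\<in>UNIV. pd j (F j) x)" and h: "continuous_on UNIV h"
  shows "integral (cbox 0 l) g = integral (cbox 0 l) h"
proof (rule integral_unique)
  have "(h has_integral integral (cbox 0 l) h) (cbox 0 l)"
    by (intro integrable_integral integrable_continuous continuous_on_subset[OF h]) auto
  from has_integral_add[OF this integral_box_div[of F, OF assms(1-3)]]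
  show "(g has_integral integral (cbox 0 l) h) (cbox 0 l)"
    unfolding assms(4)[symmetric] by simp
qed

text \<open>Since w is solenoidal, convection has divergence form; since \<phi> is solenoidal, the
  pressure drops out; symmetry of the stress turns gradients of \<phi> into symmetric gradients. The
  viscosity \<open>c\<close> is constant in space because k depends on time alone.\<close>

lemma integral_box_momentum:
  assumes phi: "C1 \<phi>" "periodic l \<phi>" "\<And>x. divergence \<phi> x = 0"
    and w: "C2 w" "periodic l w" "\<And>x. divergence w x = 0"
    and p: "C1 p" "periodic l p" and l: "\<And>j. l $ j > 0"
  shows "integral (cbox 0 l) (\<lambda>x. \<phi> x \<bullet> (jacobian w (at x) *v w x
        - tensor_div (\<lambda>y. c *\<^sub>R sym_grad w y) x + grad p x))
    = integral (cbox 0 l) (\<lambda>x. c * (sym_grad \<phi> x \<bullet> sym_grad w x) - w x \<bullet> (sym_grad \<phi> x *v w x))"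
proof (rule integral_box_eqI)
  \<comment> \<open>The flux contracts \<phi> with the momentum flux and adds the pressure times
    \<phi>.\<close>
  let ?F = "\<lambda>j x. (\<Sum>i\<in>UNIV. \<phi> x $ i * (w x $ i * w x $ j + (- c) * sym_grad w x $ i $ j)) + p x * \<phi> x $ j"
  note C = C1_add C1_mult C1_cmult C1_sum finite_class.finite_UNIV C1_nth sym_grad_C1 phi(1) w(1) C2_C1[OF w(1)] p
  show "C1 (?F j)" for j by (intro C)
  show "periodic l (?F j)" for j
    by (intro periodic_add periodic_mult periodic_cmult periodic_sum periodic_nth sym_grad_periodic phi w p)
  have pdF: "pd j (?F j) x = (\<Sum>i\<in>UNIV. pd j \<phi> x $ i * (w x $ i * w x $ j + (- c) * sym_grad w x $ i $ j)
        + \<phi> x $ i * ((pd j w x $ i * w x $ j + w x $ i * pd j w x $ j)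
            + (- c) * pd j (\<lambda>x. sym_grad w x $ i $ j) x))
      + (pd j p x * \<phi> x $ j + p x * pd j \<phi> x $ j)" for j x
    by (simp only: pd_add pd_sum pd_mult pd_cmult pd_nth C)
  have td: "tensor_div (\<lambda>y. c *\<^sub>R sym_grad w y) x $ i = (\<Sum>j\<in>UNIV. c * pd j (\<lambda>x. sym_grad w x $ i $ j) x)" for x i
    by (simp add: tensor_div_def pd_cmult sym_grad_C1 w)
  have jac: "jacobian w (at x) $ i $ j = pd j w x $ i" for x i j
    by (simp add: jacobian_def matrix_def pd_def)
  show "\<phi> x \<bullet> (jacobian w (at x) *v w x - tensor_div (\<lambda>y. c *\<^sub>R sym_grad w y) x + grad p x)
      = (c * (sym_grad \<phi> x \<bullet> sym_grad w x) - w x \<bullet> (sym_grad \<phi> x *v w x)) + (\<Sum>j\<in>UNIV. pd j (?F j) x)" for x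
  proof -
    define S where "S i j = pd j (\<lambda>x. sym_grad w x $ i $ j) x" for i j
    \<comment> \<open>Each divergence constraint, solved for its first term, becomes a rewrite rule;
      a polynomial identity in the components remains.\<close>
    have dw: "pd 1 w x $ 1 = - pd 2 w x $ 2 - pd 3 w x $ 3"
      using w(3)[of x] by (simp add: divergence_def sum_3)
    have dp: "pd 1 \<phi> x $ 1 = - pd 2 \<phi> x $ 2 - pd 3 \<phi> x $ 3"
      using phi(3)[of x] by (simp add: divergence_def sum_3)
    show ?thesis
      unfolding pdF unfolding matrix_inner inner_vec_def matrix_vector_mult_def vector_add_component vector_minus_component td jac
        S_def[symmetric] grad_def vec_lambda_beta inner_real_def sym_grad_nth sum_3 dw dp
      by (simp add: field_simps)
  qed
  show "continuous_on UNIV (\<lambda>x. c * (sym_grad \<phi> x \<bullet> sym_grad w x) - w x \<bullet> (sym_grad \<phi> x *v w x))"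
    unfolding matrix_vector_mult_def
    by (intro continuous_intros continuous_on_sym_grad C1_pd_continuous C1_continuous phi w C2_C1)
qed (use l in auto)

text \<open>For solenoidal w the integrand is the divergence of half of w times its squared length:
  convection transports kinetic energy without producing any.\<close>

lemma integral_box_convection:
  assumes w: "C1 w" "periodic l w" "\<And>x. divergence w x = 0" and l: "\<And>j. l $ j > 0"
  shows "integral (cbox 0 l) (\<lambda>x. w x \<bullet> (sym_grad w x *v w x)) = 0"
proof -
  let ?F = "\<lambda>j x. 1/2 * ((\<Sum>i\<in>UNIV. w x $ i * w x $ i) * w x $ j)"
  note C = C1_mult C1_cmult C1_sum finite_class.finite_UNIV C1_nth w
  have "integral (cbox 0 l) (\<lambda>x. w x \<bullet> (sym_grad w x *v w x)) = integral (cbox 0 l) (\<lambda>x. 0)"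
  proof (rule integral_box_eqI)
    show "C1 (?F j)" for j by (intro C)
    show "periodic l (?F j)" for j
      by (intro periodic_mult periodic_cmult periodic_sum periodic_nth w)
    have pdF: "pd j (?F j) x = 1/2 * ((\<Sum>i\<in>UNIV. pd j w x $ i * w x $ i + w x $ i * pd j w x $ i) * w x $ j
        + (\<Sum>i\<in>UNIV. w x $ i * w x $ i) * pd j w x $ j)" for j x
      by (simp only: pd_sum pd_mult pd_cmult pd_nth C)
    show "w x \<bullet> (sym_grad w x *v w x) = 0 + (\<Sum>j\<in>UNIV. pd j (?F j) x)" for x
    proof -
      have dw: "pd 1 w x $ 1 = - pd 2 w x $ 2 - pd 3 w x $ 3"
        using w(3)[of x] by (simp add: divergence_def sum_3)
      show ?thesis
        unfolding pdF unfolding inner_vec_def matrix_vector_mult_def vec_lambda_beta inner_real_def sym_grad_nth sum_3 dw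
        by (simp add: field_simps)
    qed
  qed (use l in auto)
  then show ?thesis by simp
qed

text \<open>The divergence of \<open>2 * sym_grad f\<close> is the Laplacian of f plus the gradient
  of the divergence of f, and the latter vanishes.\<close>

lemma integral_box_sym_grad_laplacian:
  assumes w: "C1 w" "periodic l w"
    and f: "C2 f" "periodic l f" "\<And>x. divergence f x = 0" and l: "\<And>j. l $ j > 0"
  shows "integral (cbox 0 l) (\<lambda>x. 2 * (sym_grad f x \<bullet> sym_grad w x))
    = integral (cbox 0 l) (\<lambda>x. - (w x \<bullet> laplacian f x))"
proof (rule integral_box_eqI)
  let ?F = "\<lambda>j x. \<Sum>i\<in>UNIV. w x $ i * (2 * sym_grad f x $ i $ j)"
  note C = C1_add C1_mult C1_cmult C1_sum finite_class.finite_UNIV C1_nth sym_grad_C1 w f(1) 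
  show "C1 (?F j)" for j by (intro C)
  show "periodic l (?F j)" for j
    by (intro periodic_mult periodic_cmult periodic_sum periodic_nth sym_grad_periodic w f)
  have pdF: "pd j (?F j) x = (\<Sum>i\<in>UNIV. pd j w x $ i * (2 * sym_grad f x $ i $ j)
     + w x $ i * (2 * (1/2 * (pd j (pd j f) x $ i + pd j (pd i f) x $ j))))" for j x
    by (simp only: pd_add pd_sum pd_mult pd_cmult pd_nth pd_sym_grad C)
  \<comment> \<open>This identifies the mixed second derivatives with the gradient of the
    divergence. \<open>pd_commute\<close> concerns scalar functions, hence the passage through
    components.\<close>
  have swap: "pd j (pd i f) x $ j = pd i (pd j f) x $ j" for i j x
  proof -
    have "pd j (pd i f) x $ j = pd j (pd i (\<lambda>x. f x $ j)) x" for i j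
      by (simp add: pd_nth_fun C2_C1 C2_C1_pd f)
    moreover have "pd i (pd j f) x $ j = pd i (pd j (\<lambda>x. f x $ j)) x" for i j
      by (simp add: pd_nth_fun C2_C1 C2_C1_pd f)
    ultimately show ?thesis using pd_commute[OF C2_nth[OF f(1)]] by metis
  qed
  have div: "(\<Sum>j\<in>UNIV. pd i (pd j f) x $ j) = 0" for i x
  proof -
    have "(\<Sum>j\<in>UNIV. pd i (pd j f) x $ j) = pd i (\<lambda>x. \<Sum>j\<in>UNIV. pd j f x $ j) x"
      by (simp add: pd_sum pd_nth C1_nth C2_C1_pd f)
    also have "\<dots> = 0" using f(3) by (simp add: divergence_def pd_const)
    finally show ?thesis .
  qed
  show "2 * (sym_grad f x \<bullet> sym_grad w x) = - (w x \<bullet> laplacian f x) + (\<Sum>j\<in>UNIV. pd j (?F j) x)" for x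
  proof -
    have d: "pd 1 (pd i f) x $ 1 = - pd 2 (pd i f) x $ 2 - pd 3 (pd i f) x $ 3" for i
      using div[of i x] by (simp add: swap[symmetric] sum_3)
    show ?thesis
      unfolding pdF unfolding matrix_inner inner_vec_def laplacian_def inner_real_def sym_grad_nth sum_3
        vector_add_component d
      by (simp add: field_simps)
  qed
  show "continuous_on UNIV (\<lambda>x. - (w x \<bullet> laplacian f x))"
    unfolding laplacian_def
    by (intro continuous_intros C1_pd_continuous C1_continuous w C2_C1_pd f)
qed (use l in auto)

text \<open>Cauchy-Schwarz in each row: the Frobenius norm dominates the operator norm.\<close>

lemma norm_matrix_vector_mult_le: "norm (A *v x) \<le> norm A * norm x" for A :: "real^'n^'m"
proof -
  have "norm (A *v x) \<le> L2_set (\<lambda>i. norm (A $ i) * norm x) UNIV"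
    unfolding norm_vec_def[of "A *v x"]
    by (intro L2_set_mono) (auto simp: matrix_vector_mul_component Cauchy_Schwarz_ineq2)
  also have "\<dots> = norm A * norm x"
    by (simp add: norm_vec_def[of A] L2_set_left_distrib)
  finally show ?thesis .
qed

section \<open>Averages over the box\<close>

lemma box_volume_pos:
  assumes "\<And>j. l $ j > 0"
  shows "measure lborel (cbox 0 (l::real^3)) > 0"
  unfolding content_pos_lt_eq using assms by (auto simp: Basis_vec_def inner_axis)

lemma box_integrable: "continuous_on UNIV (g :: real^3 \<Rightarrow> real) \<Longrightarrow> g integrable_on cbox 0 l"
  using integrable_continuous continuous_on_subset by blast

lemma box_avg_add:
  "continuous_on UNIV g \<Longrightarrow> continuous_on UNIV h \<Longrightarrow> box_avg l (\<lambda>x. g x + h x) = box_avg l g + box_avg l h"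
  by (simp add: box_avg_def integral_add box_integrable add_divide_distrib)

lemma box_avg_diff:
  "continuous_on UNIV g \<Longrightarrow> continuous_on UNIV h \<Longrightarrow> box_avg l (\<lambda>x. g x - h x) = box_avg l g - box_avg l h"
  by (simp add: box_avg_def integral_diff box_integrable diff_divide_distrib)

lemma box_avg_cmult: "box_avg l (\<lambda>x. c * g x) = c * box_avg l g"
  by (simp add: box_avg_def)

lemma box_avg_mono:
  assumes "continuous_on UNIV g" "continuous_on UNIV h" "\<And>x. x \<in> cbox 0 l \<Longrightarrow> g x \<le> h x"
  shows "box_avg l g \<le> box_avg l h"
  unfolding box_avg_def using assms by (intro divide_right_mono integral_le box_integrable) auto

lemma box_avg_nonneg: "(\<And>x. g x \<ge> 0) \<Longrightarrow> box_avg l g \<ge> 0"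
  \<comment> \<open>A non-integrable function has integral 0 by convention, which settles that
    case.\<close>
  unfolding box_avg_def by (cases "g integrable_on cbox 0 l") (auto intro!: divide_nonneg_nonneg integral_nonneg simp: not_integrable_integral)

text \<open>The average of the squared norm of \<open>a x - s *\<^sub>R b x\<close> is a nonnegative
  quadratic polynomial in \<open>s\<close>, evaluated at its minimiser
  \<open>?C / ?B\<close>.\<close>

lemma box_avg_Cauchy_Schwarz:
  fixes a b :: "real^3 \<Rightarrow> 'a::real_inner"
  assumes a: "continuous_on UNIV a" and b: "continuous_on UNIV b"
  shows "(box_avg l (\<lambda>x. a x \<bullet> b x))\<^sup>2 \<le> box_avg l (\<lambda>x. (norm (a x))\<^sup>2) * box_avg l (\<lambda>x. (norm (b x))\<^sup>2)"
proof -
  let ?A = "box_avg l (\<lambda>x. (norm (a x))\<^sup>2)" and ?B = "box_avg l (\<lambda>x. (norm (b x))\<^sup>2)"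
  let ?C = "box_avg l (\<lambda>x. a x \<bullet> b x)"
  have quad: "0 \<le> ?A - 2 * s * ?C + s\<^sup>2 * ?B" for s
  proof -
    have "0 \<le> box_avg l (\<lambda>x. (norm (a x - s *\<^sub>R b x))\<^sup>2)" by (rule box_avg_nonneg) simp
    also have "(\<lambda>x. (norm (a x - s *\<^sub>R b x))\<^sup>2)
        = (\<lambda>x. (norm (a x))\<^sup>2 - 2 * s * (a x \<bullet> b x) + s\<^sup>2 * (norm (b x))\<^sup>2)"
      unfolding power2_norm_eq_inner
      by (simp add: fun_eq_iff inner_diff inner_commute power2_eq_square algebra_simps)
    also have "box_avg l \<dots> = ?A - 2 * s * ?C + s\<^sup>2 * ?B"
      by (subst box_avg_add box_avg_diff, (intro continuous_intros a b)+)+ (simp add: box_avg_cmult)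
    finally show ?thesis .
  qed
  have B: "?B \<ge> 0" by (rule box_avg_nonneg) simp
  show ?thesis
  proof (cases "?B = 0")
    case True
    have "?C = 0"
    proof (rule ccontr)
      assume "?C \<noteq> 0"
      \<comment> \<open>With \<open>?B = 0\<close> the polynomial is affine, and this
        \<open>s\<close> gives it the value -1.\<close>
      then show False using quad[of "(?A + 1) / (2 * ?C)"] True by simp
    qed
    then show ?thesis using True by simp
  next
    case False
    then show ?thesis using quad[of "?C / ?B"] B by (simp add: field_simps power2_eq_square)
  qed
qed

section \<open>Differential inequalities and upper limits of time averages\<close>

lemma integral_le_increment:
  fixes g H :: "real \<Rightarrow> real"
  assumes ab: "b \<ge> a" and g: "continuous_on {a..b} g"
    and H: "\<And>t. t \<in> {a..b} \<Longrightarrow> \<exists>h. (H has_real_derivative h) (at t) \<and> g t \<le> h"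
  shows "integral {a..b} g \<le> H b - H a"
proof -
  obtain h where h: "\<And>t. t \<in> {a..b} \<Longrightarrow> (H has_real_derivative h t) (at t) \<and> g t \<le> h t"
    using H by metis
  \<comment> \<open>For the gauge integral every derivative is integrable, so \<open>h\<close> may
    be discontinuous.\<close>
  have "(h has_integral H b - H a) {a..b}"
    using h by (intro fundamental_theorem_of_calculus[OF ab])
      (auto simp: has_real_derivative_iff_has_vector_derivative intro: has_vector_derivative_at_within)
  then show ?thesis
    using h g by (intro has_integral_le[OF integrable_integral]) (auto intro: integrable_continuous_real)
qed

text \<open>Equality holds at \<open>n = r\<^sup>2\<close>. Trading the root for a term linear in
  \<open>n\<close> replaces a Cauchy-Schwarz step in time.\<close>

lemma young_sqrt:
  assumes "r > 0" "n \<ge> 0"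
  shows "sqrt n \<le> n / (2 * r) + r / 2"
  using sum_squares_bound[of r "sqrt n"] assms by (simp add: field_simps power2_eq_square)

lemma eventually_le_of_Limsup:
  fixes p :: "real \<Rightarrow> real"
  assumes "Limsup at_top (\<lambda>T. ereal (p T)) \<le> ereal V" "\<delta> > 0"
  shows "\<forall>\<^sub>F T in at_top. p T \<le> V + \<delta>"
proof -
  have "Limsup at_top (\<lambda>T. ereal (p T)) < ereal (V + \<delta>)"
    using assms by (auto intro: le_less_trans)
  from Limsup_lessD[OF this] show ?thesis by (rule eventually_mono) simp
qed

lemma eventually_const_divide_le:
  fixes C \<delta> :: real
  assumes "\<delta> > 0" shows "\<forall>\<^sub>F T in at_top. C / T \<le> \<delta>"
proof -
  have "((\<lambda>T. C / T) \<longlongrightarrow> 0) at_top"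
    by (rule tendsto_divide_0[OF tendsto_const filterlim_at_top_imp_at_infinity[OF filterlim_ident]])
  from order_tendstoD(2)[OF this assms] show ?thesis by (rule eventually_mono) simp
qed

lemma le_of_le_add_epsilon:
  fixes a X K :: real
  assumes K: "K > 0" and le: "\<And>\<delta>. \<delta> > 0 \<Longrightarrow> a \<le> X + \<delta> * K"
  shows "a \<le> X"
proof (rule field_le_epsilon)
  fix e :: real assume "e > 0"
  then show "a \<le> X + e" using le[of "e / K"] K by simp
qed

lemma abs_le_sqrtI: "a\<^sup>2 \<le> b * c \<Longrightarrow> \<bar>a\<bar> \<le> sqrt b * sqrt c"
  by (metis real_sqrt_abs real_sqrt_le_mono real_sqrt_mult)

section \<open>Energy and force balance\<close>

context half_equation_model
begin

definition mean_sq_velocity :: "real \<Rightarrow> real" where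
  "mean_sq_velocity t = box_avg l (\<lambda>x. (norm (v t x))\<^sup>2)"

definition mean_sq_strain :: "real \<Rightarrow> real" where
  "mean_sq_strain t = box_avg l (\<lambda>x. (norm (sym_grad (v t) x))\<^sup>2)"

definition mean_power :: "real \<Rightarrow> real" where
  "mean_power t = box_avg l (\<lambda>x. f x \<bullet> v t x)"

lemma volume_pos: "measure lborel (cbox 0 l) > 0"
  using l_pos by (rule box_volume_pos)

lemma mean_sq_velocity_nonneg: "mean_sq_velocity t \<ge> 0"
  and mean_sq_strain_nonneg: "mean_sq_strain t \<ge> 0"
  unfolding mean_sq_velocity_def mean_sq_strain_def by (auto intro: box_avg_nonneg)

lemma continuous_on_mean_sq_velocity: "continuous_on {0..} mean_sq_velocity"
proof -
  have "continuous_on ({0..} \<times> cbox 0 l) (\<lambda>(t, x). v t x)"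
    using v_cont by (rule continuous_on_subset) auto
  then have "continuous_on ({0..} \<times> cbox 0 l) (\<lambda>(t, x). (norm (v t x))\<^sup>2)"
    unfolding case_prod_beta by (intro continuous_intros)
  from integral_continuous_on_param[OF this] show ?thesis
    unfolding mean_sq_velocity_def box_avg_def using volume_pos by (intro continuous_intros) auto
qed

lemma continuous_on_mean_sq_strain: "continuous_on {0..} mean_sq_strain"
proof -
  have "continuous_on ({0..} \<times> cbox 0 l) (\<lambda>(t, x). pd i (v t) x)" for i
    using v_pd_cont by (rule continuous_on_subset) auto
  then have "continuous_on ({0..} \<times> cbox 0 l) (\<lambda>p. \<chi> i j. sym_grad (v (fst p)) (snd p) $ i $ j)"
    unfolding case_prod_beta sym_grad_nth by (intro continuous_intros)
  then have "continuous_on ({0..} \<times> cbox 0 l) (\<lambda>(t, x). (norm (sym_grad (v t) x))\<^sup>2)"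
    unfolding case_prod_beta by (intro continuous_intros) simp
  from integral_continuous_on_param[OF this] show ?thesis
    unfolding mean_sq_strain_def box_avg_def using volume_pos by (intro continuous_intros) auto
qed

lemma v_continuous: "t \<ge> 0 \<Longrightarrow> continuous_on A (v t)"
  by (intro C1_continuous v_C1)

lemma f_continuous: "continuous_on A f"
  by (intro C1_continuous C2_C1 f_C2)

lemma v_strain_continuous: "t \<ge> 0 \<Longrightarrow> continuous_on A (sym_grad (v t))"
  by (intro continuous_on_sym_grad C1_pd_continuous v_C1)

lemma f_strain_continuous: "continuous_on A (sym_grad f)"
  by (intro continuous_on_sym_grad C1_pd_continuous C2_C1 f_C2)

lemma v_t_works:
  assumes "t > ts"
  shows "((\<lambda>s. v s x) has_vector_derivative vector_derivative (\<lambda>s. v s x) (at t)) (at t within A)"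
  using v_t_ex[of t x] assms ts_nonneg vector_derivative_works has_vector_derivative_at_within by force

lemma v_t_continuous_on:
  "continuous_on ({ts<..} \<times> A) (\<lambda>(t, x). vector_derivative (\<lambda>s. v s x) (at t))"
  using v_t_cont by (rule continuous_on_subset) (use ts_nonneg in auto)

lemma v_t_continuous:
  assumes "t > ts"
  shows "continuous_on A (\<lambda>x. vector_derivative (\<lambda>s. v s x) (at t))"
proof -
  have "continuous_on A ((\<lambda>(t, x). vector_derivative (\<lambda>s. v s x) (at t)) \<circ> Pair t)"
    by (intro continuous_on_compose continuous_intros continuous_on_subset[OF v_t_continuous_on[of UNIV]])
      (use assms in auto)
  then show ?thesis by (simp add: o_def)
qed

lemma mean_power_has_derivative:
  assumes "t > ts"
  shows "(mean_power has_real_derivative box_avg l (\<lambda>x. f x \<bullet> vector_derivative (\<lambda>s. v s x) (at t))) (at t)"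
proof -
  have "((\<lambda>t. integral (cbox 0 l) (\<lambda>x. f x \<bullet> v t x)) has_real_derivative
      integral (cbox 0 l) (\<lambda>x. f x \<bullet> vector_derivative (\<lambda>s. v s x) (at t))) (at t within {ts<..})"
  proof (rule leibniz_rule_field_derivative)
    show "((\<lambda>s. f x \<bullet> v s x) has_real_derivative f x \<bullet> vector_derivative (\<lambda>s. v s x) (at t)) (at t within {ts<..})"
      if "t \<in> {ts<..}" for t x
      unfolding has_real_derivative_iff_has_vector_derivative
      using that bounded_linear.has_vector_derivative[OF bounded_linear_inner_right v_t_works] by auto
    show "(\<lambda>x. f x \<bullet> v t x) integrable_on cbox 0 l" if "t \<in> {ts<..}" for t
      using that ts_nonneg by (intro integrable_continuous continuous_intros f_continuous v_continuous) auto
    show "continuous_on ({ts<..} \<times> cbox 0 l) (\<lambda>(t, x). f x \<bullet> vector_derivative (\<lambda>s. v s x) (at t))"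
      using v_t_continuous_on[of "cbox 0 l"] unfolding case_prod_beta
      by (intro continuous_intros continuous_on_compose2[OF f_continuous[of UNIV]]) auto
  qed (use assms in auto)
  \<comment> \<open>The time interval \<open>{ts<..}\<close> is convex, as the Leibniz rule demands,
    and open, so the derivative within it is two-sided.\<close>
  then show ?thesis
    using assms unfolding mean_power_def[abs_def] box_avg_def
    by (intro DERIV_cdivide) (simp add: at_within_open[of t "{ts<..}"])
qed

lemma mean_sq_velocity_has_derivative:
  assumes "t > ts"
  shows "(mean_sq_velocity has_real_derivative
    2 * box_avg l (\<lambda>x. v t x \<bullet> vector_derivative (\<lambda>s. v s x) (at t))) (at t)"
proof -
  have "((\<lambda>t. integral (cbox 0 l) (\<lambda>x. (norm (v t x))\<^sup>2)) has_real_derivative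
      integral (cbox 0 l) (\<lambda>x. 2 * (v t x \<bullet> vector_derivative (\<lambda>s. v s x) (at t)))) (at t within {ts<..})"
  proof (rule leibniz_rule_field_derivative)
    show "((\<lambda>s. (norm (v s x))\<^sup>2) has_real_derivative 2 * (v t x \<bullet> vector_derivative (\<lambda>s. v s x) (at t))) (at t within {ts<..})"
      if "t \<in> {ts<..}" for t x
    proof -
      have "((\<lambda>s. v s x) has_vector_derivative vector_derivative (\<lambda>s. v s x) (at t)) (at t within {ts<..})"
        using that by (intro v_t_works) auto
      from bounded_bilinear.has_vector_derivative[OF bounded_bilinear_inner this this] show ?thesis
        unfolding has_real_derivative_iff_has_vector_derivative power2_norm_eq_inner
        by (simp add: inner_commute)
    qed
    show "(\<lambda>x. (norm (v t x))\<^sup>2) integrable_on cbox 0 l" if "t \<in> {ts<..}" for t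
      using that ts_nonneg by (intro integrable_continuous continuous_intros v_continuous) auto
    have "continuous_on ({ts<..} \<times> cbox 0 l) (\<lambda>(t, x). v t x)"
      using v_cont by (rule continuous_on_subset) (use ts_nonneg in auto)
    then show "continuous_on ({ts<..} \<times> cbox 0 l) (\<lambda>(t, x). 2 * (v t x \<bullet> vector_derivative (\<lambda>s. v s x) (at t)))"
      using v_t_continuous_on[of "cbox 0 l"] unfolding case_prod_beta
      by (intro continuous_intros)
  qed (use assms in auto)
  then have "(mean_sq_velocity has_real_derivative
    box_avg l (\<lambda>x. 2 * (v t x \<bullet> vector_derivative (\<lambda>s. v s x) (at t)))) (at t)"
    using assms unfolding mean_sq_velocity_def[abs_def] box_avg_def
    by (intro DERIV_cdivide) (simp add: at_within_open[of t "{ts<..}"])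
  then show ?thesis by (simp add: box_avg_cmult)
qed

text \<open>Applied twice: with \<phi> the velocity at time t for the energy equation, and with
  \<phi> the force for the force balance.\<close>

lemma weak_momentum:
  assumes t: "t > ts" and phi: "C1 \<phi>" "periodic l \<phi>" "\<And>x. divergence \<phi> x = 0"
  shows "box_avg l (\<lambda>x. \<phi> x \<bullet> vector_derivative (\<lambda>s. v s x) (at t))
    = box_avg l (\<lambda>x. \<phi> x \<bullet> f x) + box_avg l (\<lambda>x. v t x \<bullet> (sym_grad \<phi> x *v v t x))
      - (2 * \<nu> + eddy_visc \<mu> \<tau> k t) * box_avg l (\<lambda>x. sym_grad \<phi> x \<bullet> sym_grad (v t) x)"
proof -
  let ?c = "2 * \<nu> + eddy_visc \<mu> \<tau> k t"
  have t0: "t > 0" "t \<noteq> ts" using t ts_nonneg by auto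
  define G where "G x = jacobian (v t) (at x) *v v t x
        - tensor_div (\<lambda>y. ?c *\<^sub>R sym_grad (v t) y) x + grad (q t) x" for x
  have G: "G x = f x - vector_derivative (\<lambda>s. v s x) (at t)" for x
    using momentum[OF t0, of x] by (simp add: G_def algebra_simps)
  have cphi: "continuous_on UNIV \<phi>" using phi by (intro C1_continuous)
  have cS: "continuous_on UNIV (sym_grad \<phi>)" using phi by (intro continuous_on_sym_grad C1_pd_continuous)
  have "box_avg l (\<lambda>x. \<phi> x \<bullet> f x) - box_avg l (\<lambda>x. \<phi> x \<bullet> vector_derivative (\<lambda>s. v s x) (at t))
      = box_avg l (\<lambda>x. \<phi> x \<bullet> G x)"
    using box_avg_diff[of "\<lambda>x. \<phi> x \<bullet> f x" "\<lambda>x. \<phi> x \<bullet> vector_derivative (\<lambda>s. v s x) (at t)" l] t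
    by (simp add: G inner_diff_right continuous_on_inner cphi f_continuous v_t_continuous)
  also have "\<dots> = box_avg l (\<lambda>x. ?c * (sym_grad \<phi> x \<bullet> sym_grad (v t) x) - v t x \<bullet> (sym_grad \<phi> x *v v t x))"
    unfolding box_avg_def G_def using t0
    by (subst integral_box_momentum) (auto intro: phi v_C2 v_periodic incompressible q_C1 q_periodic l_pos)
  also have "\<dots> = ?c * box_avg l (\<lambda>x. sym_grad \<phi> x \<bullet> sym_grad (v t) x)
      - box_avg l (\<lambda>x. v t x \<bullet> (sym_grad \<phi> x *v v t x))"
    using t0 unfolding matrix_vector_mult_def
    by (subst box_avg_diff)
      (auto intro!: continuous_intros cS v_strain_continuous v_continuous simp: box_avg_cmult)
  finally show ?thesis by simp
qed

lemma energy_balance: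
  assumes t: "t > ts"
  shows "(mean_sq_velocity has_real_derivative
    2 * (mean_power t - (2 * \<nu> + eddy_visc \<mu> \<tau> k t) * mean_sq_strain t)) (at t)"
proof -
  have t0: "t > 0" "t \<ge> 0" using t ts_nonneg by auto
  have "box_avg l (\<lambda>x. v t x \<bullet> (sym_grad (v t) x *v v t x)) = 0"
    using integral_box_convection[OF v_C1 v_periodic incompressible l_pos] t0
    by (simp add: box_avg_def)
  then show ?thesis
    using mean_sq_velocity_has_derivative[OF t]
      weak_momentum[OF t v_C1 v_periodic incompressible] t0
    by (simp add: mean_power_def mean_sq_strain_def power2_norm_eq_inner inner_commute)
qed

lemma k_has_derivative:
  assumes "t > ts"
  shows "(k has_real_derivative
    eddy_visc \<mu> \<tau> k t * mean_sq_strain t - sqrt 2 / 2 * inverse \<tau> * k t) (at t)"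
proof -
  have "deriv k t = eddy_visc \<mu> \<tau> k t * mean_sq_strain t - sqrt 2 / 2 * inverse \<tau> * k t"
    using k_equation[OF assms] by (simp add: box_avg_cmult mean_sq_strain_def)
  then show ?thesis using field_differentiable_derivI[OF k_differentiable[OF assms]] by simp
qed

text \<open>The k-equation is linear homogeneous in k, so k keeps its initial sign.\<close>

lemma k_pos:
  assumes "T > ts"
  shows "k T > 0"
proof -
  \<comment> \<open>The k-equation says that the derivative of k is \<open>g t * k t\<close>, so
    \<open>exp (- G t)\<close> is an integrating factor.\<close>
  define g where "g t = sqrt 2 * \<mu> * \<tau> * mean_sq_strain t - sqrt 2 / 2 * inverse \<tau>" for t
  define G where "G t = integral {ts..t} g" for t
  have cont_g: "continuous_on {ts..T} g"
    unfolding g_def using ts_nonneg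
    by (intro continuous_intros continuous_on_subset[OF continuous_on_mean_sq_strain]) auto
  have dG: "(G has_real_derivative g t) (at t within {ts..T})" if "t \<in> {ts..T}" for t
    unfolding G_def using integral_has_real_derivative[OF cont_g that] .
  have "k T * exp (- G T) = k ts * exp (- G ts)"
  proof (rule DERIV_isconst_end[of ts T "\<lambda>t. k t * exp (- G t)"])
    show "continuous_on {ts..T} (\<lambda>t. k t * exp (- G t))"
      by (intro continuous_intros continuous_on_subset[OF k_cont] DERIV_continuous_on[OF dG]) auto
    fix t assume t: "ts < t" "t < T"
    then have "(G has_real_derivative g t) (at t)"
      using dG[of t] by (simp add: at_within_Icc_at)
    then show "((\<lambda>t. k t * exp (- G t)) has_real_derivative 0) (at t)"
      using k_has_derivative[OF t(1)]
      by (auto intro!: derivative_eq_intros simp: g_def eddy_visc_def algebra_simps)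
  qed (use assms in auto)
  then have "k T * exp (- G T) > 0" using k_init ks_pos by simp
  then show ?thesis by (simp add: zero_less_mult_iff)
qed

section \<open>The force and its derivatives in terms of F and L\<close>

abbreviation "F \<equiv> force_scale l f"
abbreviation "L \<equiv> length_scale l f"

text \<open>L is a minimum so that each derivative of f costs a factor 1 / L; the entry with the
  root is squared to reach the Laplacian.\<close>

lemma length_scale_props:
  assumes "meaningful_scales l f"
  shows "F > 0" "L > 0" "sup_sym_grad l f \<le> F / L" "rms_laplacian l f \<le> F / L\<^sup>2"
proof -
  show F: "F > 0" using assms by (simp add: meaningful_scales_def)
  show L: "L > 0"
    using assms volume_pos by (auto simp: length_scale_def meaningful_scales_def)
  have "L \<le> F / sup_sym_grad l f" "L \<le> sqrt (F / rms_laplacian l f)"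
    by (auto simp: length_scale_def)
  moreover from this(2) have "L\<^sup>2 \<le> (sqrt (F / rms_laplacian l f))\<^sup>2"
    using L by (intro power_mono) auto
  ultimately have "L \<le> F / sup_sym_grad l f" "L\<^sup>2 \<le> F / rms_laplacian l f"
    using assms by (auto simp: meaningful_scales_def)
  then show "sup_sym_grad l f \<le> F / L" "rms_laplacian l f \<le> F / L\<^sup>2"
    using assms L by (auto simp: meaningful_scales_def field_simps)
qed

lemma force_scale_sq: "F\<^sup>2 = box_avg l (\<lambda>x. (norm (f x))\<^sup>2)"
  unfolding force_scale_def by (simp add: box_avg_nonneg)

lemma laplacian_continuous: "continuous_on A (laplacian f)"
  unfolding laplacian_def by (intro continuous_intros C1_pd_continuous C2_C1_pd f_C2)

lemma mean_power_le: "t \<ge> 0 \<Longrightarrow> \<bar>mean_power t\<bar> \<le> F * sqrt (mean_sq_velocity t)"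
  using box_avg_Cauchy_Schwarz[OF f_continuous v_continuous, of t l]
  unfolding mean_power_def mean_sq_velocity_def force_scale_def
  by (intro abs_le_sqrtI)

lemma laplacian_pairing_le:
  assumes w: "continuous_on UNIV w"
  shows "\<bar>box_avg l (\<lambda>x. - (w x \<bullet> laplacian f x))\<bar>
    \<le> sqrt (box_avg l (\<lambda>x. (norm (w x))\<^sup>2)) * rms_laplacian l f"
proof -
  have "box_avg l (\<lambda>x. - (w x \<bullet> laplacian f x)) = - box_avg l (\<lambda>x. w x \<bullet> laplacian f x)"
    using box_avg_cmult[of l "-1"] by simp
  then show ?thesis
    using box_avg_Cauchy_Schwarz[OF w laplacian_continuous, of l]
    unfolding rms_laplacian_def by (simp add: abs_le_sqrtI)
qed

section \<open>Time averages\<close>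

abbreviation "\<epsilon> \<equiv> eps_model l \<nu> \<tau> v k"
text \<open>The time derivatives need not exist at \<open>ts\<close>; a fixed initial time interval does not
  affect the averages.\<close>

abbreviation "t0 \<equiv> ts + 1"

lemma eps_model_eq: "\<epsilon> t = \<nu> * mean_sq_strain t + sqrt 2 / 2 * inverse \<tau> * k t"
  by (simp add: eps_model_def box_avg_cmult mean_sq_strain_def)

lemma k_continuous: "continuous_on {t0..T} k"
  by (rule continuous_on_subset[OF k_cont]) auto

lemma eps_continuous: "continuous_on {t0..T} \<epsilon>"
  unfolding eps_model_eq[abs_def] using ts_nonneg
  by (intro continuous_intros k_continuous continuous_on_subset[OF continuous_on_mean_sq_strain]) auto

lemma mean_sq_velocity_continuous: "continuous_on {t0..T} mean_sq_velocity"
  using ts_nonneg by (intro continuous_on_subset[OF continuous_on_mean_sq_velocity]) auto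

text \<open>As k may jump at \<open>ts\<close>, the two sides are treated separately and
  glued.\<close>

lemma k_integrable_Icc: "k integrable_on {0..T}"
proof (cases "T \<le> ts")
  case True
  have "k integrable_on {0..ts}" using k_integrable by (simp add: absolutely_integrable_on_def)
  then show ?thesis by (rule integrable_on_subinterval) (use True in auto)
next
  case False
  have "k integrable_on {ts..T}"
    by (intro integrable_continuous_real continuous_on_subset[OF k_cont]) auto
  moreover have "k integrable_on {0..ts}" using k_integrable by (simp add: absolutely_integrable_on_def)
  ultimately show ?thesis
    using False ts_nonneg Henstock_Kurzweil_Integration.integrable_combine[of 0 ts T k] by simp
qed

lemma eps_integrable: "\<epsilon> integrable_on {0..T}"
proof -
  have "mean_sq_strain integrable_on {0..T}"
    by (intro integrable_continuous_real continuous_on_subset[OF continuous_on_mean_sq_strain]) auto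
  then have "(\<lambda>t. \<nu> * mean_sq_strain t) integrable_on {0..T}"
    and "(\<lambda>t. sqrt 2 / 2 * inverse \<tau> * k t) integrable_on {0..T}"
    using k_integrable_Icc by (auto intro!: integrable_on_mult_right)
  then show ?thesis unfolding eps_model_eq[abs_def] by (intro integrable_add)
qed

lemma mean_sq_velocity_integrable: "mean_sq_velocity integrable_on {0..T}"
  by (intro integrable_continuous_real continuous_on_subset[OF continuous_on_mean_sq_velocity]) auto

lemma eps_nonneg: "t > ts \<Longrightarrow> \<epsilon> t \<ge> 0"
  unfolding eps_model_eq using k_pos[of t] nu_pos tau_pos mean_sq_strain_nonneg[of t] by simp

abbreviation "avg \<equiv> \<lambda>(g :: real \<Rightarrow> real) T. 1 / T * integral {0..T} g"

lemma integral_split_t0: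
  fixes g :: "real \<Rightarrow> real"
  assumes "g integrable_on {0..T}" "T \<ge> t0"
  shows "integral {0..T} g = integral {0..t0} g + integral {t0..T} g"
  using Henstock_Kurzweil_Integration.integral_combine[of 0 t0 T g] assms ts_nonneg by simp

lemma integral_velocity_le:
  assumes "T \<ge> t0"
  shows "integral {t0..T} mean_sq_velocity \<le> integral {0..T} mean_sq_velocity"
  using assms ts_nonneg mean_sq_velocity_nonneg
  by (intro integral_subset_le mean_sq_velocity_integrable integrable_continuous_real mean_sq_velocity_continuous) auto

text \<open>The sign of k before \<open>ts\<close> is free, so an average up to a finite time may be
  negative. The initial interval contributes a constant divided by T, which vanishes in the
  limit.\<close>

lemma limsup_eps_nonneg: "limsup_time_avg \<epsilon> \<ge> 0"
proof -
  let ?C = "integral {0..t0} \<epsilon>"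
  have "((\<lambda>T. ereal (?C / T)) \<longlongrightarrow> ereal 0) at_top"
    by (rule tendsto_ereal[OF tendsto_divide_0[OF tendsto_const filterlim_at_top_imp_at_infinity[OF filterlim_ident]]])
  then have "Limsup at_top (\<lambda>T. ereal (?C / T)) = 0"
    by (intro lim_imp_Limsup) (auto simp: zero_ereal_def)
  moreover have "Limsup at_top (\<lambda>T. ereal (?C / T)) \<le> limsup_time_avg \<epsilon>"
    unfolding limsup_time_avg_def
  proof (rule Limsup_mono)
    show "\<forall>\<^sub>F T in at_top. ereal (?C / T) \<le> ereal (avg \<epsilon> T)"
      using eventually_ge_at_top[of t0]
    proof (rule eventually_mono)
      fix T assume T: "t0 \<le> T"
      have "integral {t0..T} \<epsilon> \<ge> 0"
        by (intro integral_nonneg integrable_continuous_real eps_continuous eps_nonneg) auto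
      then show "ereal (?C / T) \<le> ereal (avg \<epsilon> T)"
        using integral_split_t0[OF eps_integrable T] T ts_nonneg by (simp add: divide_right_mono)
    qed
  qed
  ultimately show ?thesis by simp
qed

lemma limsup_velocity_nonneg: "limsup_time_avg mean_sq_velocity \<ge> 0"
  unfolding limsup_time_avg_def
proof (rule le_Limsup)
  show "\<forall>\<^sub>F T in at_top. 0 \<le> ereal (avg mean_sq_velocity T)"
    using eventually_gt_at_top[of 0]
    by (rule eventually_mono)
      (auto intro!: divide_nonneg_pos integral_nonneg mean_sq_velocity_integrable mean_sq_velocity_nonneg)
qed simp

lemma velocity_scale_cases:
  obtains (infinite) "velocity_scale l v = \<infinity>"
  | (finite) U where "U \<ge> 0" "velocity_scale l v = ereal U" "limsup_time_avg mean_sq_velocity = ereal (U\<^sup>2)"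
proof (cases "limsup_time_avg mean_sq_velocity")
  case (real r)
  then have "r \<ge> 0" using limsup_velocity_nonneg by simp
  then show ?thesis
    using finite[of "sqrt r"] real
    by (simp add: velocity_scale_def ereal_sqrt_def mean_sq_velocity_def[abs_def])
next
  case PInf
  then show ?thesis
    using infinite by (simp add: velocity_scale_def ereal_sqrt_def mean_sq_velocity_def[abs_def])
qed (use limsup_velocity_nonneg in auto)

section \<open>Estimates for a solenoidal force\<close>

context
  assumes div_f: "\<And>x. divergence f x = 0" and scales: "meaningful_scales l f"
begin

lemmas F_pos = length_scale_props(1)[OF scales]
lemmas L_pos = length_scale_props(2)[OF scales]
lemmas sup_le = length_scale_props(3)[OF scales]
lemmas lap_le = length_scale_props(4)[OF scales]

lemma strain_pairing:
  assumes "C1 w" "periodic l w"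
  shows "2 * box_avg l (\<lambda>x. sym_grad f x \<bullet> sym_grad w x) = box_avg l (\<lambda>x. - (w x \<bullet> laplacian f x))"
  using integral_box_sym_grad_laplacian[OF assms f_C2 f_periodic div_f l_pos]
  unfolding box_avg_cmult[symmetric] by (simp add: box_avg_def)

text \<open>Interpolating between f and its Laplacian gains a factor \<open>1 / sqrt 2\<close> over the bound
  \<open>F / L\<close> that is built into the length scale. This is what brings the constant of the eddy
  viscosity term from \<open>2 \<mu>\<close> down to \<open>\<mu>\<close>, below the required \<open>sqrt 2 \<mu>\<close>.\<close>

lemma rms_sym_grad_le: "box_avg l (\<lambda>x. (norm (sym_grad f x))\<^sup>2) \<le> (F / (sqrt 2 * L))\<^sup>2"
proof -
  have "2 * box_avg l (\<lambda>x. (norm (sym_grad f x))\<^sup>2) = box_avg l (\<lambda>x. - (f x \<bullet> laplacian f x))"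
    using strain_pairing[OF C2_C1[OF f_C2] f_periodic] by (simp add: power2_norm_eq_inner)
  also have "\<dots> \<le> F * rms_laplacian l f"
    using laplacian_pairing_le[OF f_continuous] by (simp add: force_scale_def)
  also have "\<dots> \<le> F * (F / L\<^sup>2)"
    using lap_le F_pos by (intro mult_left_mono) auto
  finally have "2 * box_avg l (\<lambda>x. (norm (sym_grad f x))\<^sup>2) \<le> F * (F / L\<^sup>2)" .
  moreover have "(F / (sqrt 2 * L))\<^sup>2 = F * (F / L\<^sup>2) / 2"
    by (simp add: power_divide power_mult_distrib) (simp add: power2_eq_square)
  ultimately show ?thesis by simp
qed

text \<open>Meant for the term with constant viscosity: both derivatives are moved onto f, so that
  only the velocity remains. This is the source of the inverse Reynolds number.\<close>

lemma strain_pairing_le_velocity: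
  assumes "t \<ge> 0"
  shows "2 * box_avg l (\<lambda>x. sym_grad f x \<bullet> sym_grad (v t) x) \<le> sqrt (mean_sq_velocity t) * (F / L\<^sup>2)"
proof -
  have "2 * box_avg l (\<lambda>x. sym_grad f x \<bullet> sym_grad (v t) x)
      \<le> sqrt (mean_sq_velocity t) * rms_laplacian l f"
    using strain_pairing[OF v_C1 v_periodic, of t] laplacian_pairing_le[OF v_continuous, of t] assms
    by (simp add: mean_sq_velocity_def)
  also have "\<dots> \<le> sqrt (mean_sq_velocity t) * (F / L\<^sup>2)"
    using lap_le mean_sq_velocity_nonneg by (intro mult_left_mono) auto
  finally show ?thesis .
qed

text \<open>Meant for the eddy viscosity term, where the strain of v is kept because the energy
  equation controls \<kappa> times its mean square.\<close>

lemma strain_pairing_le_strain: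
  assumes "t \<ge> 0"
  shows "box_avg l (\<lambda>x. sym_grad f x \<bullet> sym_grad (v t) x) \<le> F / (sqrt 2 * L) * sqrt (mean_sq_strain t)"
proof -
  have "(box_avg l (\<lambda>x. sym_grad f x \<bullet> sym_grad (v t) x))\<^sup>2 \<le> (F / (sqrt 2 * L))\<^sup>2 * mean_sq_strain t"
    using box_avg_Cauchy_Schwarz[OF f_strain_continuous v_strain_continuous, of t l] assms
      mult_right_mono[OF rms_sym_grad_le mean_sq_strain_nonneg[of t]]
    by (simp add: mean_sq_strain_def)
  from abs_le_sqrtI[OF this] show ?thesis using F_pos L_pos by simp
qed

lemma convection_le:
  assumes "t \<ge> 0"
  shows "- box_avg l (\<lambda>x. v t x \<bullet> (sym_grad f x *v v t x)) \<le> F / L * mean_sq_velocity t"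
proof -
  have sup: "norm (sym_grad f x) \<le> F / L" if "x \<in> cbox 0 l" for x
  proof -
    \<comment> \<open>Compactness of the box makes the supremum a genuine upper bound.\<close>
    have "compact ((\<lambda>x. norm (sym_grad f x)) ` cbox 0 l)"
      by (intro compact_continuous_image continuous_intros f_strain_continuous) auto
    then have "norm (sym_grad f x) \<le> sup_sym_grad l f"
      unfolding sup_sym_grad_def using that
      by (intro cSUP_upper bounded_imp_bdd_above compact_imp_bounded)
    with sup_le show ?thesis by simp
  qed
  have "box_avg l (\<lambda>x. - 1 * (v t x \<bullet> (sym_grad f x *v v t x))) \<le> box_avg l (\<lambda>x. F / L * (norm (v t x))\<^sup>2)"
  proof (rule box_avg_mono)
    fix x assume x: "x \<in> cbox 0 l"
    have "- 1 * (v t x \<bullet> (sym_grad f x *v v t x)) \<le> norm (v t x) * norm (sym_grad f x *v v t x)"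
      using norm_cauchy_schwarz[of "- v t x" "sym_grad f x *v v t x"] by simp
    also have "\<dots> \<le> norm (v t x) * (norm (sym_grad f x) * norm (v t x))"
      by (intro mult_left_mono norm_matrix_vector_mult_le) auto
    also have "\<dots> \<le> norm (v t x) * (F / L * norm (v t x))"
      by (intro mult_left_mono mult_right_mono sup x) auto
    finally show "- 1 * (v t x \<bullet> (sym_grad f x *v v t x)) \<le> F / L * (norm (v t x))\<^sup>2"
      by (simp add: power2_eq_square mult_ac)
  qed (unfold matrix_vector_mult_def, (intro continuous_intros f_strain_continuous v_continuous assms)+)
  then show ?thesis unfolding box_avg_cmult mean_sq_velocity_def by simp
qed

text \<open>The momentum equation is tested with f and each term estimated. Positivity of k
  preserves the direction of the bound on the eddy viscosity term.\<close>

lemma force_balance: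
  assumes t: "t > ts"
  obtains m where "(mean_power has_real_derivative m) (at t)"
    and "F\<^sup>2 - F / L * mean_sq_velocity t - \<nu> * F * sqrt (mean_sq_velocity t) / L\<^sup>2
      - eddy_visc \<mu> \<tau> k t * (F / (sqrt 2 * L) * sqrt (mean_sq_strain t)) \<le> m"
proof
  let ?m = "box_avg l (\<lambda>x. f x \<bullet> vector_derivative (\<lambda>s. v s x) (at t))"
  let ?B = "box_avg l (\<lambda>x. sym_grad f x \<bullet> sym_grad (v t) x)"
  have t0: "t \<ge> 0" using t ts_nonneg by auto
  show "(mean_power has_real_derivative ?m) (at t)" by (rule mean_power_has_derivative[OF t])
  have "eddy_visc \<mu> \<tau> k t \<ge> 0"
    unfolding eddy_visc_def using k_pos[OF t] mu_pos tau_pos by auto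
  then have "eddy_visc \<mu> \<tau> k t * ?B \<le> eddy_visc \<mu> \<tau> k t * (F / (sqrt 2 * L) * sqrt (mean_sq_strain t))"
    by (intro mult_left_mono strain_pairing_le_strain t0)
  moreover have "\<nu> * (2 * ?B) \<le> \<nu> * (sqrt (mean_sq_velocity t) * (F / L\<^sup>2))"
    using nu_pos by (intro mult_left_mono strain_pairing_le_velocity t0) auto
  moreover have "?m = F\<^sup>2 + box_avg l (\<lambda>x. v t x \<bullet> (sym_grad f x *v v t x))
      - (2 * \<nu> + eddy_visc \<mu> \<tau> k t) * ?B"
    using weak_momentum[OF t C2_C1[OF f_C2] f_periodic div_f]
    by (simp add: force_scale_sq power2_norm_eq_inner)
  ultimately show "F\<^sup>2 - F / L * mean_sq_velocity t - \<nu> * F * sqrt (mean_sq_velocity t) / L\<^sup>2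
      - eddy_visc \<mu> \<tau> k t * (F / (sqrt 2 * L) * sqrt (mean_sq_strain t)) \<le> ?m"
    using convection_le[OF t0] by (simp add: algebra_simps)
qed

text \<open>Young's inequality makes both energy estimates linear in the mean square velocity, so that
  they can be averaged in time directly.\<close>

lemma integral_eps_le:
  assumes lam: "r > 0"
  shows "\<exists>C. \<forall>T\<ge>t0. integral {t0..T} \<epsilon>
    \<le> C + F / (2 * r) * integral {t0..T} mean_sq_velocity + F * r / 2 * (T - t0)"
proof (intro exI allI impI)
  \<comment> \<open>\<open>?H\<close> is minus the total energy. In its derivative the eddy
    dissipation of the mean flow cancels against the production of k.\<close>
  let ?N = mean_sq_velocity and ?H = "\<lambda>t. - (mean_sq_velocity t / 2 + k t)"
  fix T assume T: "T \<ge> t0"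
  have "integral {t0..T} (\<lambda>t. \<epsilon> t - F / (2 * r) * ?N t - F * r / 2) \<le> ?H T - ?H t0"
  proof (rule integral_le_increment[OF T])
    show "continuous_on {t0..T} (\<lambda>t. \<epsilon> t - F / (2 * r) * ?N t - F * r / 2)"
      by (intro continuous_intros eps_continuous mean_sq_velocity_continuous)
    fix t assume "t \<in> {t0..T}"
    then have t: "t > ts" "t \<ge> 0" using ts_nonneg by auto
    let ?h = "- ((mean_power t - (2 * \<nu> + eddy_visc \<mu> \<tau> k t) * mean_sq_strain t)
        + (eddy_visc \<mu> \<tau> k t * mean_sq_strain t - sqrt 2 / 2 * inverse \<tau> * k t))"
    have "(?H has_real_derivative ?h) (at t)"
      by (rule DERIV_cong[OF DERIV_minus[OF DERIV_add[OF DERIV_cdivide[OF energy_balance[OF t(1)]]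
              k_has_derivative[OF t(1)]]]]) (simp add: field_simps)
    moreover have "\<epsilon> t - F / (2 * r) * ?N t - F * r / 2 \<le> ?h"
    proof -
      have "mean_power t \<le> F * sqrt (?N t)" using mean_power_le[OF t(2)] by linarith
      also have "\<dots> \<le> F * (?N t / (2 * r) + r / 2)"
        using F_pos young_sqrt[OF lam mean_sq_velocity_nonneg] by (intro mult_left_mono) auto
      finally have "mean_power t \<le> F / (2 * r) * ?N t + F * r / 2" by (simp add: algebra_simps)
      \<comment> \<open>The balance dissipates twice this quantity while \<epsilon> contains it
        once; the surplus is dropped.\<close>
      moreover have "\<nu> * mean_sq_strain t \<ge> 0" using nu_pos mean_sq_strain_nonneg by simp
      ultimately show ?thesis unfolding eps_model_eq by (simp add: algebra_simps)
    qed
    ultimately show "\<exists>h. (?H has_real_derivative h) (at t) \<and> \<epsilon> t - F / (2 * r) * ?N t - F * r / 2 \<le> h" by blast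
  qed
  moreover have "integral {t0..T} (\<lambda>t. \<epsilon> t - F / (2 * r) * ?N t - F * r / 2)
      = integral {t0..T} \<epsilon> - F / (2 * r) * integral {t0..T} ?N - F * r / 2 * (T - t0)"
    using T by (subst integral_diff integral_diff integral_mult_right,
      (intro integrable_continuous_real continuous_intros eps_continuous mean_sq_velocity_continuous)+)+
      (simp add: mult.commute)
  moreover have "?H T \<le> 0"
    using mean_sq_velocity_nonneg[of T] k_pos[of T] T by simp
  ultimately show "integral {t0..T} \<epsilon>
    \<le> - ?H t0 + F / (2 * r) * integral {t0..T} ?N + F * r / 2 * (T - t0)" by linarith
qed

text \<open>The force balance times U / F is combined with half of the energy balance, whose eddy
  dissipation absorbs the strain part of Young's inequality. The price is half of the mean power: it
  lowers the coefficient of U F from 1 to 3/4 and adds F / (4 U) to that of the mean square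
  velocity.\<close>

lemma force_work_le:
  assumes U: "U > 0"
  shows "\<exists>C. \<forall>T\<ge>t0. (3 / 4 * (U * F) - \<nu> * U\<^sup>2 / (2 * L\<^sup>2)) * (T - t0)
    \<le> C + (U / L + \<nu> / (2 * L\<^sup>2) + F / (4 * U)) * integral {t0..T} mean_sq_velocity
        + \<mu> / 2 * (\<tau> * U / L)\<^sup>2 * integral {t0..T} \<epsilon>"
proof (intro exI allI impI)
  let ?N = mean_sq_velocity and ?D = mean_sq_strain
  let ?H = "\<lambda>t. U / F * mean_power t - mean_sq_velocity t / 4"
  let ?a = "3 / 4 * (U * F) - \<nu> * U\<^sup>2 / (2 * L\<^sup>2)" and ?b = "U / L + \<nu> / (2 * L\<^sup>2) + F / (4 * U)"
  let ?c = "\<mu> / 2 * (\<tau> * U / L)\<^sup>2"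
  fix T assume T: "T \<ge> t0"
  have "integral {t0..T} (\<lambda>t. ?a - ?b * ?N t - ?c * \<epsilon> t) \<le> ?H T - ?H t0"
  proof (rule integral_le_increment[OF T])
    show "continuous_on {t0..T} (\<lambda>t. ?a - ?b * ?N t - ?c * \<epsilon> t)"
      by (intro continuous_on_diff continuous_on_mult continuous_on_const eps_continuous mean_sq_velocity_continuous)
    fix t assume "t \<in> {t0..T}"
    then have t: "t > ts" "t \<ge> 0" using ts_nonneg by auto
    define \<kappa> where "\<kappa> = eddy_visc \<mu> \<tau> k t"
    obtain m where m: "(mean_power has_real_derivative m) (at t)"
      and m_ge: "F\<^sup>2 - F / L * ?N t - \<nu> * F * sqrt (?N t) / L\<^sup>2 - \<kappa> * (F / (sqrt 2 * L) * sqrt (?D t)) \<le> m"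
      unfolding \<kappa>_def by (rule force_balance[OF t(1)])
    let ?h = "U / F * m - (mean_power t - (2 * \<nu> + \<kappa>) * ?D t) / 2"
    have "(?H has_real_derivative ?h) (at t)"
      unfolding \<kappa>_def
      by (rule DERIV_cong[OF DERIV_diff[OF DERIV_cmult[OF m] DERIV_cdivide[OF energy_balance[OF t(1)]]]]) (simp add: field_simps)
    moreover have "?a - ?b * ?N t - ?c * \<epsilon> t \<le> ?h"
    proof -
      have N: "?N t \<ge> 0" and D: "?D t \<ge> 0"
        by (rule mean_sq_velocity_nonneg mean_sq_strain_nonneg)+
      have kpos: "\<kappa> \<ge> 0" unfolding \<kappa>_def eddy_visc_def using k_pos[OF t(1)] mu_pos tau_pos by auto
      have "U / F * (F\<^sup>2 - F / L * ?N t - \<nu> * F * sqrt (?N t) / L\<^sup>2 - \<kappa> * (F / (sqrt 2 * L) * sqrt (?D t))) \<le> U / F * m"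
        using m_ge U F_pos by (intro mult_left_mono) auto
      also have "U / F * (F\<^sup>2 - F / L * ?N t - \<nu> * F * sqrt (?N t) / L\<^sup>2 - \<kappa> * (F / (sqrt 2 * L) * sqrt (?D t)))
          = U * F - U / L * ?N t - \<nu> / L\<^sup>2 * (U * sqrt (?N t)) - \<kappa> * (sqrt (?D t) * (U / (sqrt 2 * L)))"
        using F_pos by (simp add: right_diff_distrib power2_eq_square mult_ac)
      finally have 1: "U * F - U / L * ?N t - \<nu> / L\<^sup>2 * (U * sqrt (?N t)) - \<kappa> * (sqrt (?D t) * (U / (sqrt 2 * L))) \<le> U / F * m" .
      have "U * sqrt (?N t) \<le> ?N t / 2 + U\<^sup>2 / 2"
        using sum_squares_bound[of U "sqrt (?N t)"] N by simp
      then have 2: "\<nu> / L\<^sup>2 * (U * sqrt (?N t)) \<le> \<nu> / L\<^sup>2 * (?N t / 2 + U\<^sup>2 / 2)"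
        using nu_pos by (intro mult_left_mono) auto
      \<comment> \<open>Young's inequality is balanced so that exactly \<kappa> / 2 times the mean
        square strain appears, which \<open>?h\<close> compensates.\<close>
      have "sqrt (?D t) * (U / (sqrt 2 * L)) \<le> ?D t / 2 + U\<^sup>2 / (4 * L\<^sup>2)"
        using sum_squares_bound[of "sqrt (?D t)" "U / (sqrt 2 * L)"] D
        by (simp add: power_divide power_mult_distrib)
      then have 3: "\<kappa> * (sqrt (?D t) * (U / (sqrt 2 * L))) \<le> \<kappa> * (?D t / 2 + U\<^sup>2 / (4 * L\<^sup>2))"
        using kpos by (intro mult_left_mono)
      have "mean_power t \<le> F * sqrt (?N t)" using mean_power_le[OF t(2)] by linarith
      also have "\<dots> \<le> F * (?N t / (2 * U) + U / 2)"
        using F_pos young_sqrt[OF U N] by (intro mult_left_mono) auto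
      finally have 4: "mean_power t \<le> F * (?N t / (2 * U) + U / 2)" .
      \<comment> \<open>The eddy viscosity is proportional to the k-part of \<epsilon>, so its
        remaining contribution is bounded by a multiple of \<epsilon>.\<close>
      have "\<kappa> = 2 * \<mu> * \<tau>\<^sup>2 * (sqrt 2 / 2 * inverse \<tau> * k t)"
        unfolding \<kappa>_def eddy_visc_def using tau_pos by (simp add: field_simps power2_eq_square)
      then have "\<kappa> * (U\<^sup>2 / (4 * L\<^sup>2)) = ?c * (sqrt 2 / 2 * inverse \<tau> * k t)"
        by (simp add: power_divide power_mult_distrib)
      also have "\<dots> \<le> ?c * \<epsilon> t"
        unfolding eps_model_eq using mu_pos nu_pos D by (intro mult_left_mono) auto
      finally have 5: "\<kappa> * (U\<^sup>2 / (4 * L\<^sup>2)) \<le> ?c * \<epsilon> t" .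
      have 6: "\<nu> * ?D t \<ge> 0" using nu_pos D by simp
      have 7: "?b * ?N t = U / L * ?N t + \<nu> / L\<^sup>2 * (?N t / 2) + F * (?N t / (2 * U)) / 2"
        and 8: "\<nu> * U\<^sup>2 / (2 * L\<^sup>2) = \<nu> / L\<^sup>2 * (U\<^sup>2 / 2)"
        by (simp_all add: algebra_simps)
      have 9: "(2 * \<nu> + \<kappa>) * ?D t = 2 * (\<nu> * ?D t) + 2 * (\<kappa> * (?D t / 2))" and 10: "F * (U / 2) = U * F / 2"
        by (simp_all add: algebra_simps)
      \<comment> \<open>With all products abstracted to variables, the estimates combine by linear
        arithmetic.\<close>
      have linear: "3 / 4 * u - b' - (a + b + p / 2) - z \<le> s - (w - (2 * d + 2 * x)) / 2"
        if "u - a - n - r \<le> s" "n \<le> b + b'" "r \<le> x + y" "w \<le> p + u / 2" "y \<le> z" "d \<ge> 0"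
        for u a n r s b b' x y w p z d :: real
        using that by (simp add: field_simps)
      show ?thesis
        unfolding 7 8 9 by (rule linear[OF 1 2[unfolded distrib_left] 3[unfolded distrib_left]
              4[unfolded distrib_left 10] 5 6])
    qed
    ultimately show "\<exists>h. (?H has_real_derivative h) (at t) \<and> ?a - ?b * ?N t - ?c * \<epsilon> t \<le> h" by blast
  qed
  moreover have "integral {t0..T} (\<lambda>t. ?a - ?b * ?N t - ?c * \<epsilon> t)
      = ?a * (T - t0) - ?b * integral {t0..T} ?N - ?c * integral {t0..T} \<epsilon>"
  proof -
    have int: "?N integrable_on {t0..T}" "\<epsilon> integrable_on {t0..T}"
      by (intro integrable_continuous_real eps_continuous mean_sq_velocity_continuous)+
    have lin: "integral {t0..T} (\<lambda>t. a - b * ?N t - c * \<epsilon> t)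
      = a * (T - t0) - b * integral {t0..T} ?N - c * integral {t0..T} \<epsilon>" for a b c
      using T int
      by (simp add: integral_diff integrable_diff integrable_on_mult_right integrable_const_ivl mult.commute)
    show ?thesis by (rule lin)
  qed
  \<comment> \<open>The term - N/4 in \<open>?H\<close> absorbs the growth of the mean power, giving
    a bound independent of T.\<close>
  moreover have "?H T \<le> U\<^sup>2"
  proof -
    have "U / F * mean_power T \<le> U / F * (F * sqrt (?N T))"
      using mean_power_le[of T] T ts_nonneg U F_pos by (intro mult_left_mono) auto
    then have "U / F * mean_power T \<le> U * sqrt (?N T)" using F_pos by simp
    also have "\<dots> \<le> ?N T / 4 + U\<^sup>2"
      using sum_squares_bound[of U "sqrt (?N T) / 2"] mean_sq_velocity_nonneg[of T]
      by (simp add: power_divide)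
    finally show ?thesis by simp
  qed
  ultimately show "?a * (T - t0) \<le> (U\<^sup>2 - ?H t0) + ?b * integral {t0..T} ?N + ?c * integral {t0..T} \<epsilon>"
    by linarith
qed

section \<open>Division by T and passage to upper limits\<close>

lemma avg_eps_le:
  assumes r: "r > 0"
  shows "\<exists>C. \<forall>T\<ge>t0. avg \<epsilon> T \<le> C / T + F / (2 * r) * avg mean_sq_velocity T + F * r / 2"
proof -
  obtain C where C: "\<And>T. T \<ge> t0 \<Longrightarrow> integral {t0..T} \<epsilon>
      \<le> C + F / (2 * r) * integral {t0..T} mean_sq_velocity + F * r / 2 * (T - t0)"
    using integral_eps_le[OF r] by blast
  show ?thesis
  proof (intro exI allI impI)
    fix T assume T: "T \<ge> t0"
    then have T0: "T > 0" using ts_nonneg by simp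
    have "F / (2 * r) * integral {t0..T} mean_sq_velocity \<le> F / (2 * r) * integral {0..T} mean_sq_velocity"
      using F_pos r by (intro mult_left_mono integral_velocity_le T) auto
    moreover have "F * r / 2 * (T - t0) \<le> F * r / 2 * T"
      using F_pos r ts_nonneg by (intro mult_left_mono) auto
    ultimately have "integral {0..T} \<epsilon>
        \<le> (integral {0..t0} \<epsilon> + C) + F / (2 * r) * integral {0..T} mean_sq_velocity + F * r / 2 * T"
      using C[OF T] integral_split_t0[OF eps_integrable T] by linarith
    from divide_right_mono[OF this, of T]
    show "avg \<epsilon> T \<le> (integral {0..t0} \<epsilon> + C) / T + F / (2 * r) * avg mean_sq_velocity T + F * r / 2"
      using T0 by (simp add: add_divide_distrib)
  qed
qed

lemma force_avg_le:
  assumes U: "U > 0"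
  shows "\<exists>C. \<forall>T\<ge>t0. 3 / 4 * (U * F) - \<nu> * U\<^sup>2 / (2 * L\<^sup>2)
    \<le> C / T + (U / L + \<nu> / (2 * L\<^sup>2) + F / (4 * U)) * avg mean_sq_velocity T
        + \<mu> / 2 * (\<tau> * U / L)\<^sup>2 * avg \<epsilon> T"
proof -
  define a where "a = 3 / 4 * (U * F) - \<nu> * U\<^sup>2 / (2 * L\<^sup>2)"
  define b where "b = U / L + \<nu> / (2 * L\<^sup>2) + F / (4 * U)"
  define c where "c = \<mu> / 2 * (\<tau> * U / L)\<^sup>2"
  have b: "b \<ge> 0" using U L_pos F_pos nu_pos by (simp add: b_def)
  obtain C where C: "\<And>T. T \<ge> t0 \<Longrightarrow> a * (T - t0)
      \<le> C + b * integral {t0..T} mean_sq_velocity + c * integral {t0..T} \<epsilon>"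
    using force_work_le[OF U] unfolding a_def b_def c_def by blast
  show ?thesis
    unfolding a_def[symmetric] b_def[symmetric] c_def[symmetric]
  proof (intro exI allI impI)
    fix T assume T: "T \<ge> t0"
    then have T0: "T > 0" using ts_nonneg by simp
    have "b * integral {t0..T} mean_sq_velocity \<le> b * integral {0..T} mean_sq_velocity"
      using b by (intro mult_left_mono integral_velocity_le T)
    \<comment> \<open>An exact splitting, since \<epsilon> may be negative before \<open>ts\<close>;
      for the mean square velocity monotonicity suffices.\<close>
    moreover have "c * integral {0..T} \<epsilon> = c * integral {0..t0} \<epsilon> + c * integral {t0..T} \<epsilon>"
      using integral_split_t0[OF eps_integrable T] by (simp add: distrib_left)
    ultimately have "a * T \<le> (C + a * t0 - c * integral {0..t0} \<epsilon>) + b * integral {0..T} mean_sq_velocity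
        + c * integral {0..T} \<epsilon>"
      using C[OF T] right_diff_distrib[of a T t0] by linarith
    from divide_right_mono[OF this, of T]
    show "a \<le> (C + a * t0 - c * integral {0..t0} \<epsilon>) / T + b * avg mean_sq_velocity T + c * avg \<epsilon> T"
      using T0 by (simp add: add_divide_distrib)
  qed
qed

text \<open>The weight \<open>r\<close> stays free: for V the square of U, taking \<open>r\<close>
  equal to U gives F U, and letting \<open>r\<close> tend to 0 settles U = 0.\<close>

lemma limsup_eps_le:
  assumes V: "limsup_time_avg mean_sq_velocity = ereal V" and r: "r > 0"
  obtains e where "limsup_time_avg \<epsilon> = ereal e" "e \<ge> 0" "e \<le> F / (2 * r) * V + F * r / 2"
proof -
  define b where "b = F / (2 * r)"
  have b: "b > 0" using F_pos r by (simp add: b_def)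
  obtain C where C: "\<And>T. T \<ge> t0 \<Longrightarrow> avg \<epsilon> T \<le> C / T + b * avg mean_sq_velocity T + F * r / 2"
    using avg_eps_le[OF r] unfolding b_def by blast
  have le: "limsup_time_avg \<epsilon> \<le> ereal (b * V + F * r / 2 + \<delta> * (1 + b))" if d: "\<delta> > 0" for \<delta>
    unfolding limsup_time_avg_def
  proof (rule Limsup_bounded)
    have "\<forall>\<^sub>F T in at_top. T \<ge> t0 \<and> C / T \<le> \<delta> \<and> avg mean_sq_velocity T \<le> V + \<delta>"
      using V d by (intro eventually_conj eventually_ge_at_top eventually_const_divide_le eventually_le_of_Limsup)
        (auto simp: limsup_time_avg_def)
    then show "\<forall>\<^sub>F T in at_top. ereal (avg \<epsilon> T) \<le> ereal (b * V + F * r / 2 + \<delta> * (1 + b))"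
    proof (rule eventually_mono)
      fix T assume T: "T \<ge> t0 \<and> C / T \<le> \<delta> \<and> avg mean_sq_velocity T \<le> V + \<delta>"
      then have "b * avg mean_sq_velocity T \<le> b * (V + \<delta>)"
        using b by (intro mult_left_mono) auto
      then show "ereal (avg \<epsilon> T) \<le> ereal (b * V + F * r / 2 + \<delta> * (1 + b))"
        using C[of T] T by (simp add: algebra_simps)
    qed
  qed
  obtain e where e: "limsup_time_avg \<epsilon> = ereal e"
    using le[OF zero_less_one] limsup_eps_nonneg by (cases "limsup_time_avg \<epsilon>") simp_all
  show ?thesis
  proof
    show "limsup_time_avg \<epsilon> = ereal e" by (rule e)
    show "e \<ge> 0" using limsup_eps_nonneg e by simp
    show "e \<le> F / (2 * r) * V + F * r / 2"
      unfolding b_def[symmetric]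
    proof (rule le_of_le_add_epsilon)
      show "1 + b > 0" using b by simp
      show "e \<le> b * V + F * r / 2 + \<delta> * (1 + b)" if "\<delta> > 0" for \<delta>
        using le[OF that] unfolding e by simp
    qed
  qed
qed

text \<open>Averaging \<open>force_work_le\<close> bounds U F / 2 by the scaling term plus
  \<open>c * e\<close>, and \<open>e\<close> is at most U F.\<close>

lemma limsup_eps_bound:
  assumes V: "limsup_time_avg mean_sq_velocity = ereal (U\<^sup>2)" and U: "U > 0"
  obtains e where "limsup_time_avg \<epsilon> = ereal e" "e \<ge> 0"
    "(1 - \<mu> * (\<tau> * U / L)\<^sup>2) * e \<le> 2 * ((1 + \<nu> / (L * U)) * (U ^ 3 / L))"
proof -
  obtain e where e: "limsup_time_avg \<epsilon> = ereal e" "e \<ge> 0" and FU: "e \<le> F / (2 * U) * U\<^sup>2 + F * U / 2"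
    using limsup_eps_le[OF V U] .
  define a where "a = 3 / 4 * (U * F) - \<nu> * U\<^sup>2 / (2 * L\<^sup>2)"
  define b where "b = U / L + \<nu> / (2 * L\<^sup>2) + F / (4 * U)"
  define c where "c = \<mu> / 2 * (\<tau> * U / L)\<^sup>2"
  have b: "b \<ge> 0" using U L_pos F_pos nu_pos by (simp add: b_def)
  have c: "c \<ge> 0" using mu_pos by (simp add: c_def)
  obtain C where C: "\<And>T. T \<ge> t0 \<Longrightarrow> a \<le> C / T + b * avg mean_sq_velocity T + c * avg \<epsilon> T"
    using force_avg_le[OF U] unfolding a_def b_def c_def by blast
  have "a \<le> b * U\<^sup>2 + c * e"
  proof (rule le_of_le_add_epsilon)
    show "1 + b + c > 0" using b c by simp
    fix \<delta> :: real assume d: "\<delta> > 0"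
    \<comment> \<open>Both averages enter with nonnegative coefficients, so one T at which neither
      exceeds its upper limit by more than \<open>\<delta>\<close> suffices.\<close>
    have "\<forall>\<^sub>F T in at_top. T \<ge> t0 \<and> C / T \<le> \<delta> \<and> avg mean_sq_velocity T \<le> U\<^sup>2 + \<delta> \<and> avg \<epsilon> T \<le> e + \<delta>"
      using V d e by (intro eventually_conj eventually_ge_at_top eventually_const_divide_le eventually_le_of_Limsup)
        (auto simp: limsup_time_avg_def)
    from eventually_happens'[OF _ this] obtain T where T: "T \<ge> t0" "C / T \<le> \<delta>" "avg mean_sq_velocity T \<le> U\<^sup>2 + \<delta>" "avg \<epsilon> T \<le> e + \<delta>"
      by auto
    have "b * avg mean_sq_velocity T \<le> b * (U\<^sup>2 + \<delta>)" "c * avg \<epsilon> T \<le> c * (e + \<delta>)"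
      by (rule mult_left_mono[OF T(3) b] mult_left_mono[OF T(4) c])+
    then show "a \<le> b * U\<^sup>2 + c * e + \<delta> * (1 + b + c)"
      using C[OF T(1)] T(2) by (simp add: algebra_simps)
  qed
  moreover have "b * U\<^sup>2 - a = (1 + \<nu> / (L * U)) * (U ^ 3 / L) - U * F / 2"
    unfolding a_def b_def using U L_pos by (simp add: field_simps power2_eq_square power3_eq_cube)
  moreover have "e \<le> U * F" using FU U by (simp add: power2_eq_square)
  ultimately have "e - 2 * (c * e) \<le> 2 * ((1 + \<nu> / (L * U)) * (U ^ 3 / L))" by argo
  then have "(1 - \<mu> * (\<tau> * U / L)\<^sup>2) * e \<le> 2 * ((1 + \<nu> / (L * U)) * (U ^ 3 / L))"
    by (simp add: c_def left_diff_distrib mult.assoc)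
  then show thesis using e that by blast
qed

end

end

section \<open>Transfer to the extended reals, by cases on the velocity scale\<close>

theorem theorem1:
  fixes l :: "real^3" and \<nu> \<tau> \<mu> ts ks :: real
    and f v0 :: "real^3 \<Rightarrow> real^3"
    and v :: "real \<Rightarrow> real^3 \<Rightarrow> real^3" and q :: "real \<Rightarrow> real^3 \<Rightarrow> real" and k :: "real \<Rightarrow> real"
  assumes "half_equation_model l \<nu> \<tau> \<mu> f v0 ts ks v q k"
    and "\<And>x. divergence f x = 0"
    and "meaningful_scales l f"
  shows "((1 - ereal (sqrt 2 * \<mu>) * (ereal \<tau> / turnover_time l f v)^2)
           * limsup_time_avg (eps_model l \<nu> \<tau> v k)
         \<le> 2 * (1 + inverse (reynolds l \<nu> f v)) * (velocity_scale l v ^ 3 / ereal (length_scale l f)))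
    \<and> (\<mu> = 0.55 \<longrightarrow> ereal \<tau> / turnover_time l f v \<le> ereal 0.8 \<longrightarrow>
         limsup_time_avg (eps_model l \<nu> \<tau> v k)
         \<le> 4 * (1 + inverse (reynolds l \<nu> f v)) * (velocity_scale l v ^ 3 / ereal (length_scale l f)))"
proof -
  interpret half_equation_model l \<nu> \<tau> \<mu> f v0 ts ks v q k by fact
  let ?L = "length_scale l f" and ?E = "limsup_time_avg (eps_model l \<nu> \<tau> v k)"
  have L: "?L > 0" by (rule length_scale_props(2)[OF assms(3)])
  show ?thesis
  proof (cases rule: velocity_scale_cases)
    case infinite
    \<comment> \<open>The inverse Reynolds number is 0 here and the right-hand sides are
      infinite.\<close>
    have "reynolds l \<nu> f v = \<infinity>"
      using infinite L nu_pos by (simp add: reynolds_def)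
    moreover have "velocity_scale l v ^ 3 / ereal ?L = \<infinity>"
      using infinite L by (simp add: power3_eq_cube)
    ultimately show ?thesis by simp
  next
    case (finite U)
    show ?thesis
    proof (cases "U = 0")
      case True
      obtain e where e: "?E = ereal e" "e \<ge> 0"
        using limsup_eps_le[OF assms(2,3) finite(3) zero_less_one] by blast
      have "e \<le> 0"
      proof (rule le_of_le_add_epsilon)
        show "force_scale l f / 2 > 0" using length_scale_props(1)[OF assms(3)] by simp
        fix r :: real assume "r > 0"
        then obtain e' where "?E = ereal e'" "e' \<le> force_scale l f / (2 * r) * U\<^sup>2 + force_scale l f * r / 2"
          using limsup_eps_le[OF assms(2,3) finite(3)] by blast
        then show "e \<le> 0 + r * (force_scale l f / 2)" using e(1) True by (simp add: mult.commute)
      qed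
      with e have "?E = 0" by (simp add: zero_ereal_def)
      then show ?thesis using finite(2) True by (simp add: zero_ereal_def[symmetric] power3_eq_cube)
    next
      case False
      then have U: "U > 0" using finite by simp
      let ?x = "\<tau> * U / ?L" and ?A = "(1 + \<nu> / (?L * U)) * (U ^ 3 / ?L)"
      obtain e where e: "?E = ereal e" "e \<ge> 0" "(1 - \<mu> * ?x\<^sup>2) * e \<le> 2 * ?A"
        using limsup_eps_bound[OF assms(2,3) finite(3) U] .
      have x: "ereal \<tau> / turnover_time l f v = ereal ?x"
        using finite(2) U L by (simp add: turnover_time_def)
      have Re: "inverse (reynolds l \<nu> f v) = ereal (\<nu> / (?L * U))"
        using finite(2) U L nu_pos by (simp add: reynolds_def)
      have rhs: "c * (1 + inverse (reynolds l \<nu> f v)) * (velocity_scale l v ^ 3 / ereal ?L)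
          = ereal (c' * ?A)" if "c = ereal c'" for c c'
        using finite(2) L by (simp add: Re that one_ereal_def mult.assoc)
      have sq: "ereal (sqrt 2 * \<mu>) * (ereal ?x)\<^sup>2 = ereal (sqrt 2 * \<mu> * ?x\<^sup>2)" by simp
      have "(1 - sqrt 2 * \<mu> * ?x\<^sup>2) * e \<le> (1 - \<mu> * ?x\<^sup>2) * e"
      \<comment> \<open>Replacing \<mu> by \<open>sqrt 2 * \<mu>\<close> weakens the bound because
        \<open>e\<close> is nonnegative.\<close>
      proof -
        have "1 * (\<mu> * ?x\<^sup>2) \<le> sqrt 2 * (\<mu> * ?x\<^sup>2)"
          using mu_pos by (intro mult_right_mono) auto
        then show ?thesis using e(2) by (intro mult_right_mono) auto
      qed
      then have 1: "(1 - sqrt 2 * \<mu> * ?x\<^sup>2) * e \<le> 2 * ?A" using e(3) by linarith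
      have 2: "e \<le> 4 * ?A" if "\<mu> = 0.55" "?x \<le> 0.8"
      proof -
        \<comment> \<open>0.55 times 0.64 is 0.352, so the bracket is at least 1/2 and the constant
          2 at most doubles.\<close>
        have "?x\<^sup>2 \<le> 0.8\<^sup>2" using that(2) U L tau_pos by (intro power_mono) auto
        also have "(0.8::real)\<^sup>2 = 16 / 25" by (simp add: power2_eq_square)
        finally have "11 / 20 * ?x\<^sup>2 \<le> 1 / 2" by simp
        moreover have "\<mu> * ?x\<^sup>2 = 11 / 20 * ?x\<^sup>2" unfolding that(1) by simp
        ultimately have "1 / 2 \<le> 1 - \<mu> * ?x\<^sup>2" by linarith
        then have "1 / 2 * e \<le> (1 - \<mu> * ?x\<^sup>2) * e" using e(2) by (intro mult_right_mono)
        then show ?thesis using e(3) by linarith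
      qed
      have "(1 - ereal (sqrt 2 * \<mu>) * (ereal ?x)\<^sup>2) * ereal e \<le> ereal (2 * ?A)"
        unfolding sq one_ereal_def using 1 by simp
      then show ?thesis
        unfolding x e(1) rhs[of 2 2, OF numeral_eq_ereal] rhs[of 4 4, OF numeral_eq_ereal] using 2 by simp
    qed
  qed
qed

end
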